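(* Let $(X_i,\mathcal{F}_i)_{i\ge 0}$ be a supermartingale difference sequence, and for each $i\ge 1$ let $B_i$ be an $\mathcal{F}_{i-1}$-measurable, nonzero real random variable with $\mathbb{P}(X_i\le B_i\mid\mathcal{F}_{i-1})=1$ almost surely. Let $\sigma_i^2:=\mathbb{E}[X_i^2\mid\mathcal{F}_{i-1}]$, \[ s_i:=\frac12\left(B_i+\frac{\sigma_i^2}{B_i}\right),\qquad V_k^2:=\sum_{i=1}^k s_i^2,\qquad \mathcal{E}_k:=\left\{\sum_{i=1}^k X_i\ge x\ \text{ and }\ V_k^2\le v^2\right\}. \] Then for any $n\ge 1$, $x\ge 0$ and $0<v<\infty$, with $Z\sim N(0,1)$, \[ \mathbb{P}\left(\bigcup_{k=1}^n\mathcal{E}_k\right)\le\inf_{\lambda\ge 0}\mathbb{E}\left[\left(1+\frac{\lambda}{5}(vZ-x)\right)_+^5\right]\le 5!\,(e/5)^5\,\mathbb{P}(vZ\ge x). \] In particular, \[ \mathbb{P}\left(\sum_{i=1}^n X_i\ge x\ \text{ and }\ \sum_{i=1}^n s_i^2\le v^2\ \text{ for some } n\ge 1\right)\le\inf_{\lambda\ge 0}\mathbb{E}\left[\left(1+\frac{\lambda}{5}(vZ-x)\right)_+^5\right]. \]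
   Context: A supermartingale difference sequence $(X_i,\mathcal{F}_i)_{i\ge0}$ consists of a filtration $(\mathcal{F}_i)_{i\ge 0}$ and integrable real random variables $X_i$, with $X_0=0$, such that $X_i$ is $\mathcal{F}_i$-measurable and $\mathbb{E}[X_i\mid\mathcal{F}_{i-1}]\le 0$ almost surely for $i\ge 1$. Notation: $u_+=\max\{u,0\}$ and $u_+^{\alpha}=(u_+)^{\alpha}$. *)

theory Defs
  imports "HOL-Probability.Probability"
begin

definition supermartingale_difference ::
  "'a measure \<Rightarrow> (nat \<Rightarrow> 'a measure) \<Rightarrow> (nat \<Rightarrow> 'a \<Rightarrow> real) \<Rightarrow> bool" where
  "supermartingale_difference M F X \<longleftrightarrow>
     filtration (space M) F \<and> (\<forall>i. subalgebra M (F i)) \<and>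
     (\<forall>i. integrable M (X i)) \<and> (\<forall>i. X i \<in> borel_measurable (F i)) \<and>
     (AE \<omega> in M. X 0 \<omega> = 0) \<and>
     (\<forall>i\<ge>1. AE \<omega> in M. real_cond_exp M (F (i - 1)) (X i) \<omega> \<le> 0)"

(* X i need not be square integrable, so the conditional second moment is taken with values in
   [0, \<infinity>]; the real-valued real_cond_exp would return 0 where it is infinite. *)
definition cond_square ::
  "'a measure \<Rightarrow> (nat \<Rightarrow> 'a measure) \<Rightarrow> (nat \<Rightarrow> 'a \<Rightarrow> real) \<Rightarrow> nat \<Rightarrow> 'a \<Rightarrow> ennreal" where
  "cond_square M F X i = nn_cond_exp M (F (i - 1)) (\<lambda>\<omega>. ennreal ((X i \<omega>)\<^sup>2))"

(* B i may be negative, so s_i takes values in the extended reals; where the conditional second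
   moment is infinite (and B i \<omega> \<noteq> 0), s_i = \<plusminus>\<infinity> and s_i\<^sup>2 = \<infinity>. *)
definition s_coeff ::
  "'a measure \<Rightarrow> (nat \<Rightarrow> 'a measure) \<Rightarrow> (nat \<Rightarrow> 'a \<Rightarrow> real) \<Rightarrow> (nat \<Rightarrow> 'a \<Rightarrow> real)
     \<Rightarrow> nat \<Rightarrow> 'a \<Rightarrow> ereal" where
  "s_coeff M F X B i \<omega> =
     ereal (1/2) * (ereal (B i \<omega>) + enn2ereal (cond_square M F X i \<omega>) / ereal (B i \<omega>))"

definition V_square ::
  "'a measure \<Rightarrow> (nat \<Rightarrow> 'a measure) \<Rightarrow> (nat \<Rightarrow> 'a \<Rightarrow> real) \<Rightarrow> (nat \<Rightarrow> 'a \<Rightarrow> real)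
     \<Rightarrow> nat \<Rightarrow> 'a \<Rightarrow> ereal" where
  "V_square M F X B k \<omega> = (\<Sum>i=1..k. (s_coeff M F X B i \<omega>)\<^sup>2)"

definition tail_event ::
  "'a measure \<Rightarrow> (nat \<Rightarrow> 'a measure) \<Rightarrow> (nat \<Rightarrow> 'a \<Rightarrow> real) \<Rightarrow> (nat \<Rightarrow> 'a \<Rightarrow> real)
     \<Rightarrow> real \<Rightarrow> real \<Rightarrow> nat \<Rightarrow> 'a set" where
  "tail_event M F X B x v k =
     {\<omega> \<in> space M. (\<Sum>i=1..k. X i \<omega>) \<ge> x \<and> V_square M F X B k \<omega> \<le> ereal (v\<^sup>2)}"

end

theory Submission
  imports Defs
begin

text \<open>
  Write \<open>g u = u\<^sub>+^5\<close> and \<open>G t s = E g(t + s Z)\<close>. Among the laws bounded above by \<open>b > 0\<close> with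
  nonpositive mean and second moment \<open>\<sigma>\<^sup>2\<close>, the expectation of \<open>g(t + X)\<close> is largest for the centred law on
  \<open>{- \<sigma>\<^sup>2/b, b}\<close>, as a parabola touching \<open>g\<close> at the first atom and meeting it at the second one shows. For that
  law the expectation is at most \<open>G t s\<close> with \<open>s = (b + \<sigma>\<^sup>2/b)/2\<close>, half the distance of the atoms;
  for \<open>b < 0\<close> simply \<open>g(t + X) \<le> g t \<le> G t s\<close>. Since independent Gaussians add up,
  \<open>G (S\<^sub>k - w) (sqrt (v\<^sup>2 - V\<^sub>k\<^sup>2))\<close> is a supermartingale as long as \<open>V\<^sub>k \<le> v\<close>, and on \<open>S\<^sub>k \<ge> x\<close> it is at
  least \<open>g (x - w)\<close>. Stopping at the first such \<open>k\<close> bounds the probability by \<open>G (- w) v / g (x - w)\<close>, and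
  \<open>w = x - 5/\<lambda>\<close> gives the first estimate. The second one compares the normal density with an
  exponential density.
\<close>

subsection \<open>Polynomial inequalities\<close>

text \<open>The comparison with the normal law is delicate for skewed atoms. When both atoms lie in
  the positive range, comparing plain fifth moments is not enough: their difference
  \<open>skew_poly\<close> is negative for some small \<open>p\<close>. What saves the estimate is
  truncation, since the normal law still has mass on the side where \<open>u ^ 5\<close> is negative
  and \<open>pos5\<close> gains \<open>gauss_pos5 (- c) 1\<close> there. The rational constants come
  from splitting the range of skewness and shift so that each piece is a polynomial inequality with
  some room.

  On the probabilistic side, \<open>X i\<close> need not be square integrable and its conditional
  second moment may be infinite. The one-step bound is therefore proved on sets where the parabola's
  coefficients and the second moment are bounded, then extended by monotone convergence. The
  variance budget is predictable: whether step \<open>k + 1\<close> exceeds it is known at time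
  \<open>k\<close>, so such paths are discarded before the step and the square root of the remaining
  budget always makes sense.\<close>

lemma power5_weight_le:
  fixes m y :: real
  assumes "0 < m" "0 \<le> y"
  shows "(m - y) / 2 * y ^ 5 \<le> 3125 / 93312 * m ^ 6"
proof -
  \<comment> \<open>The left side is maximal at \<open>y = 5 * m / 6\<close>, that is
    \<open>s = 1\<close>, with value \<open>3125/93312 * m ^ 6\<close>; this explains the double
    root of \<open>1 - 6 * s^5 + 5 * s^6\<close>.\<close>
  define s where "s = 6 * y / (5 * m)"
  have y: "y = 5 * m * s / 6" using assms by (simp add: s_def)
  have s: "0 \<le> s" using assms by (simp add: s_def)
  have "(1 - s)\<^sup>2 * (1 + 2 * s + 3 * s^2 + 4 * s^3 + 5 * s^4) = 1 - 6 * s^5 + 5 * s^6" by algebra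
  moreover have "0 \<le> (1 - s)\<^sup>2 * (1 + 2 * s + 3 * s^2 + 4 * s^3 + 5 * s^4)" using s by simp
  ultimately have "6 * s^5 - 5 * s^6 \<le> 1" by linarith
  hence "3125/93312 * m^6 * (6 * s^5 - 5 * s^6) \<le> 3125/93312 * m^6 * 1"
    using assms by (intro mult_left_mono) auto
  moreover have "(m - y) / 2 * y ^ 5 = 3125/93312 * m^6 * (6 * s^5 - 5 * s^6)"
  proof -
    have "(m - y) / 2 = m * (6 - 5 * s) / 12" by (simp add: y field_simps)
    moreover have "y ^ 5 = 3125 / 7776 * m ^ 5 * s ^ 5" by (simp add: y power_mult_distrib power_divide)
    ultimately have "(m - y) / 2 * y ^ 5 = m * (6 - 5 * s) / 12 * (3125 / 7776 * m ^ 5 * s ^ 5)"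
      by (simp only:)
    also have "\<dots> = 3125/93312 * m^6 * (6 * s^5 - 5 * s^6)"
      by (simp add: algebra_simps power_numeral_reduce)
    finally show ?thesis .
  qed
  ultimately show ?thesis by simp
qed

text \<open>With \<open>e = p - c / 2\<close> the left side is
  \<open>16 * (c + 2 * e) * (1 - e) ^ 5\<close>, whose slope at \<open>e = 0\<close> is a positive
  multiple of \<open>2 - 5 * c\<close>. So \<open>2/5\<close> is exactly the threshold from which
  the endpoint \<open>e = 0\<close> is optimal.\<close>

lemma power5_boundary_le:
  fixes p c :: real
  assumes "2/5 \<le> c" "c \<le> 2 * p" "p \<le> 1"
  shows "p * (2 * (1 - p) + c) ^ 5 \<le> 16 * c"
proof -
  define e where "e = p - c / 2"
  have e: "0 \<le> e" "e \<le> 1" using assms by (auto simp: e_def)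
  have e': "p * (2 * (1 - p) + c) ^ 5 = 16 * ((c + 2 * e) * (1 - e) ^ 5)"
    by (simp add: e_def power_mult_distrib field_simps)
  have "2 * e \<le> c * (5 * e)" using assms e mult_right_mono[of "2/5" c "5*e"] by simp
  hence "c + 2 * e \<le> c * (1 + 5 * e)" by (simp add: algebra_simps)
  also have "\<dots> \<le> c * (1 + e) ^ 5"
    using Bernoulli_inequality[of e 5] assms e by (intro mult_left_mono) auto
  finally have "(c + 2 * e) * (1 - e) ^ 5 \<le> c * (1 + e) ^ 5 * (1 - e) ^ 5"
    using e by (intro mult_right_mono) auto
  also have "\<dots> = c * (1 - e\<^sup>2) ^ 5"
    by (simp add: power_mult_distrib[symmetric] mult.assoc) (simp add: algebra_simps power2_eq_square)
  also have "\<dots> \<le> c * 1" using e assms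
    by (intro mult_left_mono power_le_one) (auto simp: power_le_one)
  finally show ?thesis using e' by simp
qed

text \<open>For \<open>r = sqrt (2/pi)\<close> the right side is half the expectation of
  \<open>(\<bar>Z\<bar> - w) ^ 5\<close>, the bound of \<open>gauss_pos5_ge_abs\<close>. It
  increases with \<open>r\<close>, so the rational lower bound \<open>797/1000\<close> of
  \<open>sqrt (2/pi)\<close> can replace it.\<close>

lemma taylor_poly_ge:
  fixes w r :: real
  assumes "-2/5 \<le> w" "w \<le> 1" "797/1000 \<le> r"
  shows "3125/93312 * (2 - w) ^ 6 \<le> 4*r - 15/2*w + 10*r*w^2 - 5*w^3 + 5/2*r*w^4 - w^5/2"
proof -
  have r: "797/1000 * (4 + 10*w^2 + 5/2*w^4) \<le> r * (4 + 10*w^2 + 5/2*w^4)"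
    using assms by (intro mult_right_mono) auto
  have "3125/93312 * (2 - w) ^ 6 \<le> 335/10000 * (2 - w) ^ 6"
    by (intro mult_right_mono) auto
  moreover have "335/10000 * (2 - w) ^ 6 \<le> 797/1000 * (4 + 10*w^2 + 5/2*w^4) - 15/2*w - 5*w^3 - w^5/2"
  proof -
    have ex: "(2 - w)^6 = 64 - 192*w + 240*w^2 - 160*w^3 + 60*w^4 - 12*w^5 + w^6" by algebra
    show ?thesis
    proof (cases "0 \<le> w")
      case True
      \<comment> \<open>In the difference of the two sides only the constant and the coefficient of
        \<open>w^3\<close> are positive, so these replacements lose in the safe direction. The
        tangent of \<open>w^3\<close> at \<open>1\<close> then leaves a linear inequality.\<close>
      have "w^2 \<le> w" "w^4 \<le> w^3" "w^5 \<le> w^3" "w^6 \<le> w^3"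
        using True assms power_decreasing[of 1 2 w] power_decreasing[of 3 4 w]
          power_decreasing[of 3 5 w] power_decreasing[of 3 6 w] by auto
      moreover have "3*w - 2 \<le> w^3"
      proof -
        have "w^3 - 3*w + 2 = (w - 1)^2 * (w + 2)" by algebra
        moreover have "\<dots> \<ge> 0" using True by simp
        ultimately show ?thesis by linarith
      qed
      ultimately show ?thesis unfolding ex using assms by (simp add: algebra_simps)
    next
      case False
      define c where "c = - w"
      have c: "0 \<le> c" "c \<le> 2/5" "w = - c" using False assms by (auto simp: c_def)
      have "c^2 \<le> c" "c^3 \<le> c" "c^4 \<le> c" "c^6 \<le> c" "0 \<le> c^5"
        using c power_decreasing[of 1 2 c] power_decreasing[of 1 3 c]
          power_decreasing[of 1 4 c] power_decreasing[of 1 6 c] by auto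
      moreover have "w^2 = c^2" "w^3 = - (c^3)" "w^4 = c^4" "w^5 = - (c^5)" "w^6 = c^6"
        by (simp_all add: c(3))
      ultimately show ?thesis unfolding ex using c by argo
    qed
  qed
  ultimately show ?thesis using r by argo
qed

text \<open>
  For \<open>Y = \<plusminus>1\<close> with \<open>P(Y = 1) = p\<close>, \<open>d = 1 - 2 * p\<close> and \<open>c \<ge> 2 * p\<close>, this is
  \<open>E(c + Z)^5 - E(c + Y - E Y)^5\<close>; see \<open>two_point_power5\<close>.
\<close>

definition skew_poly :: "real \<Rightarrow> real \<Rightarrow> real" where
  "skew_poly d c = 10*d^2*c^3 - 20*d*(1-d^2)*c^2 + (10 - 10*d^2 + 15*d^4)*c - 4*d*(1-d^4)"

text \<open>Multiplied by \<open>d\<close>, the polynomial depends only on \<open>y = d * c\<close>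
  and \<open>d^2\<close>, and the only harmful term is \<open>d^2 * (4 + 10*y - 20*y^2)\<close>.
  There \<open>d^2\<close> is bounded by a multiple of \<open>y\<close> when \<open>y\<close> is
  small and by the constant \<open>81/400\<close> otherwise.\<close>

lemma skew_poly_small_skewness:
  assumes "0 < d" "d \<le> 9/20" "1 - d \<le> c"
  shows "0 \<le> skew_poly d c"
proof -
  define y where "y = d * c"
  have y0: "11/20 * d \<le> y" using mult_left_mono[of "11/20" c d] assms by (auto simp: y_def)
  have yp: "0 < y" using y0 assms by linarith
  have ey: "d\<^sup>2 \<le> 9/11 * y" using y0 assms mult_left_mono[of d "9/20" d] unfolding power2_eq_square by linarith
  have e5: "d\<^sup>2 \<le> 81/400" using assms power_mono[of d "9/20" 2] by (simp add: power2_eq_square)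
  have "d * skew_poly d c = 10*y*(1-y)^2 - d^2*(4 + 10*y - 20*y^2) + 15*d^4*y + 4*d^6"
    unfolding skew_poly_def y_def by algebra
  moreover have "d^2*(4 + 10*y - 20*y^2) \<le> 10*y*(1-y)^2"
  proof (cases "4 + 10*y - 20*y^2 \<le> 0")
    case True
    hence "d^2*(4 + 10*y - 20*y^2) \<le> 0" by (rule mult_nonneg_nonpos[OF zero_le_power2])
    also have "0 \<le> 10*y*(1-y)^2" using yp by simp
    finally show ?thesis .
  next
    case False
    hence ypos: "0 < 4 + 10*y - 20*y^2" by simp
    have y1: "y \<le> 4/5"
    proof (rule ccontr)
      assume "\<not> ?thesis"
      hence "y * (4/5) \<le> y * y" using yp by (intro mult_left_mono) auto
      thus False using ypos \<open>\<not> y \<le> 4/5\<close> unfolding power2_eq_square by linarith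
    qed
    show ?thesis
    proof (cases "y \<le> 1/4")
      case True
      have "d^2*(4 + 10*y - 20*y^2) \<le> 9/11*y*(4 + 10*y - 20*y^2)"
        using ey ypos by (intro mult_right_mono) auto
      also have "\<dots> = y * (9/11*(4 + 10*y - 20*y^2))" by simp
      also have "\<dots> \<le> y * (10*(1-y)^2)"
      proof (intro mult_left_mono)
        show "9/11*(4 + 10*y - 20*y^2) \<le> 10*(1-y)^2"
        proof -
          have "10*(1-y)^2 - 9/11*(4 + 10*y - 20*y^2) = 290/11 * (1/4 - y)^2 + 15 * (1/4 - y) + 117/88"
            by (simp add: power2_eq_square field_simps)
          moreover have "0 \<le> 290/11 * (1/4 - y)^2" by simp
          moreover have "0 \<le> 15 * (1/4 - y)" using True by simp
          ultimately show ?thesis by linarith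
        qed
      qed (use yp in auto)
      finally show ?thesis by simp
    next
      case False
      have "d^2*(4 + 10*y - 20*y^2) \<le> 81/400*(4 + 10*y - 20*y^2)"
        using e5 ypos by (intro mult_right_mono) auto
      also have "\<dots> \<le> 10*y*(1-y)^2"
      proof -
        have "10*y*(1-y)^2 - 81/400*(4 + 10*y - 20*y^2)
            = 10*(y - 1/4)*(y - 4/5)^2 + 51/20*(y - 97/204)^2 + (79/100 - 9409/16320)"
          by (simp add: power2_eq_square field_simps)
        moreover have "0 \<le> 10*(y - 1/4)*(y - 4/5)^2" using False by simp
        moreover have "0 \<le> 51/20*(y - 97/204)^2" by simp
        ultimately show ?thesis by linarith
      qed
      finally show ?thesis .
    qed
  qed
  ultimately have "0 \<le> d * skew_poly d c" using yp by (simp add: add_nonneg_nonneg)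
  thus ?thesis using assms by (simp add: zero_le_mult_iff)
qed
text \<open>At \<open>c = 1 - d = 2 * p\<close> the lower atom lands on 0 and the upper one
  contributes \<open>32 * p = 16 * c\<close>; this is subtracted from
  \<open>c^5 + 10*c^3 + 15*c\<close>.\<close>

lemma skew_poly_boundary: "skew_poly d (1 - d) = (1 - d)^5 + 10 * (1 - d)^3 - (1 - d)"
  unfolding skew_poly_def by algebra

text \<open>Completing the square in the derivative leaves a remainder that is nonnegative once
  \<open>d^2\<close> is at least \<open>1/5\<close>. The bound \<open>9/20\<close> lies just above
  \<open>sqrt (1/5)\<close> and fixes the border between small and large skewness.\<close>

lemma skew_poly_mono:
  assumes "9/20 \<le> d" "0 \<le> c" "c \<le> c'"
  shows "skew_poly d c \<le> skew_poly d c'"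
proof (rule DERIV_nonneg_imp_nondecreasing[OF assms(3)])
  fix y
  have d: "81/400 \<le> d\<^sup>2" "0 < d" using assms power_mono[of "9/20" d 2] by (auto simp: power2_eq_square)
  have "(skew_poly d has_real_derivative
    (30*d^2*y^2 - 40*d*(1-d^2)*y + (10 - 10*d^2 + 15*d^4))) (at y)"
    unfolding skew_poly_def by (auto intro!: derivative_eq_intros simp: algebra_simps)
  moreover have "30*d^2*y^2 - 40*d*(1-d^2)*y + (10 - 10*d^2 + 15*d^4)
    = 30 * (d * y - 2/3 * (1 - d^2))^2 + (5/3 * d^4 + 50/3 * d^2 - 10/3)" by algebra
  moreover have "0 \<le> 5/3 * d^4 + 50/3 * d^2 - 10/3" using d zero_le_power[of d 4] by linarith
  ultimately show "\<exists>l. (skew_poly d has_real_derivative l) (at y) \<and> 0 \<le> l" by auto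
qed

lemma skew_poly_ge:
  assumes "9/20 \<le> d" "d \<le> 1" "1 - d \<le> c"
  shows "- 13/100 \<le> skew_poly d c"
proof -
  have "- 13/100 \<le> 10 * t^3 - t" if "0 \<le> t" for t :: real
  proof -
    \<comment> \<open>\<open>183/1000\<close> approximates the minimiser \<open>1 / sqrt 30\<close>
      of \<open>10 * t^3 - t\<close>, where the value is about \<open>-0.122\<close>.\<close>
    have "10 * t^3 - t + 13/100
        = 10 * (t - 183/1000)^2 * (t + 183/500) + 467/100000 * t + 743026/100000000"
      by (simp add: power2_eq_square power3_eq_cube field_simps)
    moreover have "0 \<le> 10 * (t - 183/1000)^2 * (t + 183/500)" using that by simp
    ultimately show ?thesis using that by linarith
  qed
  hence "- 13/100 \<le> skew_poly d (1 - d)" unfolding skew_poly_boundary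
    using assms zero_le_power[of "1 - d" 5] by (smt (verit))
  thus ?thesis using skew_poly_mono[of d "1 - d" c] assms by linarith
qed

text \<open>By monotonicity only the smallest admissible \<open>c\<close> matters. It is
  \<open>1 - d\<close> up to \<open>d = 3/5\<close> and \<open>2/5\<close> from there on.\<close>

lemma skew_poly_nonneg_large:
  assumes "9/20 \<le> d" "d \<le> 1" "1 - d \<le> c" "2/5 \<le> c"
  shows "0 \<le> skew_poly d c"
proof (cases "d \<le> 3/5")
  case True
  have "10 * (1-d)^3 \<ge> (1 - d)"
  proof -
    have "1 \<le> 10 * (1-d)^2" using True power_mono[of "2/5" "1-d" 2] by (simp add: power2_eq_square)
    hence "(1 - d) * 1 \<le> (1 - d) * (10 * (1-d)^2)" using assms by (intro mult_left_mono) auto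
    thus ?thesis by (simp add: power2_eq_square power3_eq_cube algebra_simps)
  qed
  hence "0 \<le> skew_poly d (1 - d)" unfolding skew_poly_boundary
    using assms zero_le_power[of "1 - d" 5] by linarith
  thus ?thesis using skew_poly_mono[of d "1 - d" c] assms by linarith
next
  case False
  have "skew_poly d (2/5) \<le> skew_poly d c" using assms by (intro skew_poly_mono) auto
  moreover have "0 \<le> skew_poly d (2/5)"
  proof -
    define e where "e = d - 3/5"
    have "skew_poly d (2/5) = 4*e^5 + 18*e^4 + 32*e^3 + 24*e^2 + 782/3125"
      unfolding skew_poly_def e_def by (simp add: power_numeral_reduce field_simps)
    thus ?thesis using False by (simp add: e_def)
  qed
  ultimately show ?thesis by linarith
qed

subsection \<open>The function \<open>u\<^sub>+^5\<close> and its parabolic majorants\<close>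

definition pos5 :: "real \<Rightarrow> real" where
  "pos5 u = (max u 0) ^ 5"

lemma pos5_nonneg [simp]: "0 \<le> pos5 u"
  by (simp add: pos5_def)

lemma pos5_eq: "0 \<le> u \<Longrightarrow> pos5 u = u ^ 5"
  by (simp add: pos5_def)

lemma pos5_eq_0: "u \<le> 0 \<Longrightarrow> pos5 u = 0"
  by (simp add: pos5_def)

lemma pos5_mono: "u \<le> u' \<Longrightarrow> pos5 u \<le> pos5 u'"
  unfolding pos5_def by (intro power_mono) auto

lemma pos5_mult: "0 \<le> s \<Longrightarrow> pos5 (s * u) = s ^ 5 * pos5 u"
  unfolding pos5_def power_mult_distrib[symmetric] by (cases "s = 0") (auto simp: max_mult_distrib_left)

lemma pos5_minus: "pos5 u = u ^ 5 + pos5 (- u)"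
  by (cases "0 \<le> u") (auto simp: pos5_def max_def)

lemma power5_le_pos5: "u ^ 5 \<le> pos5 u"
  using pos5_minus[of u] pos5_nonneg[of "- u"] by linarith

lemma pos5_le_abs: "pos5 u \<le> \<bar>u\<bar> ^ 5"
  unfolding pos5_def by (intro power_mono) auto

lemma borel_measurable_pos5 [measurable]: "pos5 \<in> borel_measurable borel"
  unfolding pos5_def by measurable

definition pos5_remainder :: "real \<Rightarrow> real \<Rightarrow> real" where
  "pos5_remainder c y = pos5 (c + y) - pos5 c - 5 * (max c 0) ^ 4 * y"

lemma pos5_remainder_eq:
  assumes "0 < c" "- c \<le> y"
  shows "pos5_remainder c y = y\<^sup>2 * (10*c^3 + 10*c^2*y + 5*c*y^2 + y^3)"
proof -
  have "pos5_remainder c y = (c + y)^5 - c^5 - 5*c^4*y"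
    using assms by (simp add: pos5_remainder_def pos5_eq)
  also have "\<dots> = y\<^sup>2 * (10*c^3 + 10*c^2*y + 5*c*y^2 + y^3)" by algebra
  finally show ?thesis .
qed

lemma pos5_remainder_nonneg:
  assumes "0 < Y"
  shows "0 \<le> pos5_remainder c Y"
proof (cases "0 < c")
  case True
  thus ?thesis using assms by (subst pos5_remainder_eq) auto
next
  case False
  thus ?thesis by (simp add: pos5_remainder_def pos5_eq_0)
qed

text \<open>The second derivative of \<open>pos5\<close> is nondecreasing, and the Taylor remainder
  divided by \<open>y^2\<close> is a weighted mean of it between \<open>c\<close> and
  \<open>c + y\<close>, up to a constant factor. The product form avoids dividing by zero at
  \<open>y = 0\<close>.\<close>

lemma pos5_remainder_quotient_mono:
  assumes "y \<le> Y" "0 < Y"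
  shows "pos5_remainder c y * Y\<^sup>2 \<le> pos5_remainder c Y * y\<^sup>2"
proof (cases "0 < c")
  case c: True
  define R where "R = (\<lambda>y. 10*c^3 + 10*c^2*y + 5*c*y^2 + y^3)"
  have Y: "pos5_remainder c Y = Y\<^sup>2 * R Y"
    using c assms by (simp add: pos5_remainder_eq R_def)
  show ?thesis
  proof (cases "- c \<le> y")
    case True
    have "R Y - R y = (Y - y) * (10 * (c + (Y + y) / 4)^2 + (Y + y)^2 / 8 + (Y - y)^2 / 4)"
      unfolding R_def by (simp add: power2_eq_square power3_eq_cube field_simps)
    also have "\<dots> \<ge> 0" using assms by simp
    finally have "R y \<le> R Y" by simp
    hence "y\<^sup>2 * R y * Y\<^sup>2 \<le> y\<^sup>2 * R Y * Y\<^sup>2"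
      by (intro mult_left_mono mult_right_mono) auto
    thus ?thesis using True c by (simp add: Y pos5_remainder_eq R_def mult_ac)
  next
    case False
    \<comment> \<open>\<open>10 * c^3\<close>, the limit of the quotient at \<open>y = 0\<close>,
      separates the two quotients: it bounds this one from above and \<open>R Y\<close> from
      below.\<close>
    have "pos5_remainder c y = - (c^5) - 5 * c^4 * y"
      using False c by (simp add: pos5_remainder_def pos5_eq_0 pos5_eq)
    also have "\<dots> = 10 * c^3 * y^2 - c^3 * (10 * (y + c/4)^2 + 3/8 * c^2)"
      by (simp add: power_numeral_reduce field_simps)
    also have "\<dots> \<le> 10 * c^3 * y^2" using c by simp
    also have "\<dots> \<le> R Y * y^2"
      using c assms by (intro mult_right_mono) (auto simp: R_def)
    finally have "pos5_remainder c y * Y^2 \<le> R Y * y^2 * Y^2" by (intro mult_right_mono) auto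
    thus ?thesis by (simp add: Y mult_ac)
  qed
next
  case False
  hence c: "c \<le> 0" by simp
  have eq: "pos5_remainder c z = pos5 (c + z)" for z
    using c by (simp add: pos5_remainder_def pos5_eq_0)
  show ?thesis
  proof (cases "c + y \<le> 0")
    case True
    thus ?thesis by (simp add: eq pos5_eq_0)
  next
    case False
    hence y: "0 < c + y" "0 < y" using c by auto
    \<comment> \<open>Here the quotient is \<open>(c + y) ^ 3 * ((c + y) / y) ^ 2\<close>, and both
      factors increase with \<open>y\<close> because \<open>c \<le> 0\<close>.\<close>
    have "c * Y \<le> c * y" using c assms by (intro mult_left_mono_neg) auto
    moreover have "0 \<le> (c + y) * Y" using y assms by simp
    ultimately have "((c + y) * Y)^2 \<le> ((c + Y) * y)^2"
      by (intro power_mono) (simp_all add: algebra_simps)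
    moreover have "(c + y)^3 \<le> (c + Y)^3" using y assms by (intro power_mono) auto
    ultimately have "(c + y)^3 * ((c + y) * Y)^2 \<le> (c + Y)^3 * ((c + Y) * y)^2"
      using y assms by (intro mult_mono) auto
    thus ?thesis using y assms by (simp add: eq pos5_eq power_mult_distrib power_numeral_reduce mult_ac)
  qed
qed

text \<open>
  Coefficients of the parabola in \<open>u\<close> that touches \<open>pos5 (t + u)\<close> at \<open>u = - a\<close> and meets it at
  \<open>u = b\<close>. It lies above \<open>pos5 (t + u)\<close> for all \<open>u \<le> b\<close>, because \<open>pos5_remainder c y / y\<^sup>2\<close> increases
  with \<open>y\<close>.
\<close>

definition majorant2 :: "real \<Rightarrow> real \<Rightarrow> real \<Rightarrow> real" where
  "majorant2 t a b = pos5_remainder (t - a) (a + b) / (a + b)\<^sup>2"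

definition majorant1 :: "real \<Rightarrow> real \<Rightarrow> real \<Rightarrow> real" where
  "majorant1 t a b = 5 * (max (t - a) 0) ^ 4 + 2 * a * majorant2 t a b"

definition majorant0 :: "real \<Rightarrow> real \<Rightarrow> real \<Rightarrow> real" where
  "majorant0 t a b = pos5 (t - a) + 5 * (max (t - a) 0) ^ 4 * a + a\<^sup>2 * majorant2 t a b"

lemma majorant2_nonneg: "0 \<le> a \<Longrightarrow> 0 < b \<Longrightarrow> 0 \<le> majorant2 t a b"
  by (simp add: majorant2_def pos5_remainder_nonneg)

text \<open>This sign lets the linear term be dropped when the mean is only known to be
  nonpositive.\<close>

lemma majorant1_nonneg: "0 \<le> a \<Longrightarrow> 0 < b \<Longrightarrow> 0 \<le> majorant1 t a b"
  by (simp add: majorant1_def majorant2_nonneg)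

lemma pos5_le_majorant:
  assumes "0 \<le> a" "0 < b" "u \<le> b"
  shows "pos5 (t + u) \<le> majorant0 t a b + majorant1 t a b * u + majorant2 t a b * u\<^sup>2"
proof -
  have "pos5_remainder (t - a) (u + a) \<le> majorant2 t a b * (u + a)\<^sup>2"
    using pos5_remainder_quotient_mono[of "u + a" "a + b" "t - a"] assms
    by (simp add: majorant2_def field_simps)
  thus ?thesis
    by (simp add: pos5_remainder_def majorant0_def majorant1_def algebra_simps power2_eq_square)
qed

text \<open>The centred law on \<open>- a\<close> and \<open>b\<close> has weights
  \<open>b / (a + b)\<close> and \<open>a / (a + b)\<close> and second moment \<open>a * b\<close>.
  The parabola agrees with \<open>pos5\<close> at both atoms, so the two expectations
  coincide.\<close>

lemma majorant_two_point:
  assumes "0 \<le> a" "0 < b"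
  shows "majorant0 t a b + majorant2 t a b * (a * b)
    = (b * pos5 (t - a) + a * pos5 (t + b)) / (a + b)"
proof -
  have "a + b \<noteq> 0" using assms by simp
  have *: "majorant2 t a b * (a + b) = pos5_remainder (t - a) (a + b) / (a + b)"
    using \<open>a + b \<noteq> 0\<close> by (simp add: majorant2_def power2_eq_square)
  have "majorant0 t a b + majorant2 t a b * (a * b)
    = pos5 (t - a) + 5 * (max (t - a) 0) ^ 4 * a + a * (pos5_remainder (t - a) (a + b) / (a + b))"
  proof -
    have "a\<^sup>2 * m + m * (a * b) = a * (m * (a + b))" for m :: real
      by (simp add: power2_eq_square algebra_simps)
    thus ?thesis using * by (simp add: majorant0_def add.assoc)
  qed
  also have "\<dots> = (b * pos5 (t - a) + a * pos5 (t + b)) / (a + b)"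
    using \<open>a + b \<noteq> 0\<close> by (simp add: pos5_remainder_def field_simps)
  finally show ?thesis .
qed

lemma borel_measurable_majorant [measurable (raw)]:
  assumes [measurable]: "t \<in> borel_measurable M" "a \<in> borel_measurable M" "b \<in> borel_measurable M"
  shows "(\<lambda>x. majorant0 (t x) (a x) (b x)) \<in> borel_measurable M"
    "(\<lambda>x. majorant1 (t x) (a x) (b x)) \<in> borel_measurable M"
    "(\<lambda>x. majorant2 (t x) (a x) (b x)) \<in> borel_measurable M"
  unfolding majorant0_def majorant1_def majorant2_def pos5_remainder_def by measurable

subsection \<open>Normal domination of centred two-point laws\<close>

lemma integrable_std_normal_poly_abs:
  "integrable lborel (\<lambda>z. std_normal_density z * (a + b * \<bar>z\<bar>) ^ n)"
proof -
  have "integrable lborel (\<lambda>z. \<Sum>k\<le>n. of_nat (n choose k) * a ^ k * b ^ (n - k)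
      * (std_normal_density z * \<bar>z\<bar> ^ (n - k)))"
    by (intro Bochner_Integration.integrable_sum Bochner_Integration.integrable_mult_right integrable_std_normal_moment_abs)
  thus ?thesis by (simp add: binomial_ring sum_distrib_left power_mult_distrib mult_ac)
qed

lemma integrable_std_normal_pos5:
  "integrable lborel (\<lambda>z. std_normal_density z * pos5 (t + s * z))"
proof (rule Bochner_Integration.integrable_bound)
  show "integrable lborel (\<lambda>z. std_normal_density z * (\<bar>t\<bar> + \<bar>s\<bar> * \<bar>z\<bar>) ^ 5)"
    by (rule integrable_std_normal_poly_abs)
  have "pos5 (t + s * z) \<le> (\<bar>t\<bar> + \<bar>s\<bar> * \<bar>z\<bar>) ^ 5" for z
  proof (rule order_trans[OF pos5_le_abs])
    show "\<bar>t + s * z\<bar> ^ 5 \<le> (\<bar>t\<bar> + \<bar>s\<bar> * \<bar>z\<bar>) ^ 5"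
      by (intro power_mono) (auto simp: abs_mult[symmetric])
  qed
  thus "AE z in lborel. norm (std_normal_density z * pos5 (t + s * z))
      \<le> norm (std_normal_density z * (\<bar>t\<bar> + \<bar>s\<bar> * \<bar>z\<bar>) ^ 5)"
    by (intro AE_I2) (auto simp: abs_mult intro!: mult_left_mono)
qed measurable

definition gauss_pos5 :: "real \<Rightarrow> real \<Rightarrow> real" where
  "gauss_pos5 t s = (\<integral>z. std_normal_density z * pos5 (t + s * z) \<partial>lborel)"

lemma gauss_pos5_nonneg [simp]: "0 \<le> gauss_pos5 t s"
  unfolding gauss_pos5_def by (intro Bochner_Integration.integral_nonneg) simp

lemma std_normal_integral_reflect:
  fixes h :: "real \<Rightarrow> real"
  shows "(\<integral>z. std_normal_density z * h (- z) \<partial>lborel) = (\<integral>z. std_normal_density z * h z \<partial>lborel)"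
proof -
  have "(\<integral>z. std_normal_density z * h z \<partial>lborel)
      = (\<integral>z. std_normal_density (0 + (-1) * z) * h (0 + (-1) * z) \<partial>lborel)"
    using lborel_integral_real_affine[of "-1" "\<lambda>z. std_normal_density z * h z" 0] by simp
  thus ?thesis by (simp add: std_normal_density_def)
qed

lemma gauss_pos5_minus: "gauss_pos5 t (- s) = gauss_pos5 t s"
  using std_normal_integral_reflect[of "\<lambda>z. pos5 (t + s * z)"] by (simp add: gauss_pos5_def)

lemma gauss_pos5_scale:
  assumes "0 \<le> c"
  shows "gauss_pos5 (c * t) (c * s) = c ^ 5 * gauss_pos5 t s"
proof -
  have "pos5 (c * t + c * s * z) = c ^ 5 * pos5 (t + s * z)" for z
    using pos5_mult[OF assms, of "t + s * z"] by (simp add: algebra_simps)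
  thus ?thesis unfolding gauss_pos5_def by (simp add: mult.left_commute[of _ "c^5"])
qed

section \<open>Fifth moments of the shifted normal law and lower bounds for its truncated
  moment\<close>

lemma std_normal_power5_expectation:
  "has_bochner_integral lborel (\<lambda>z. std_normal_density z * (c + z) ^ 5) (c^5 + 10*c^3 + 15*c)"
proof -
  note e = std_normal_moment_even and o = std_normal_moment_odd
  have "has_bochner_integral lborel (\<lambda>z.
      c^5 * (std_normal_density z * z ^ (2 * 0)) + 5*c^4 * (std_normal_density z * z ^ (2 * 0 + 1))
    + 10*c^3 * (std_normal_density z * z ^ (2 * 1)) + 10*c^2 * (std_normal_density z * z ^ (2 * 1 + 1))
    + 5*c * (std_normal_density z * z ^ (2 * 2)) + 1 * (std_normal_density z * z ^ (2 * 2 + 1)))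
    (c^5 * (fact (2 * 0) / (2^0 * fact 0)) + 5*c^4 * 0 + 10*c^3 * (fact (2 * 1) / (2^1 * fact 1)) + 10*c^2 * 0
     + 5*c * (fact (2 * 2) / (2^2 * fact 2)) + 1 * 0)"
    by (intro has_bochner_integral_add has_bochner_integral_mult_right e o)
  moreover have "c^5 * (std_normal_density z * z ^ (2 * 0)) + 5*c^4 * (std_normal_density z * z ^ (2 * 0 + 1))
    + 10*c^3 * (std_normal_density z * z ^ (2 * 1)) + 10*c^2 * (std_normal_density z * z ^ (2 * 1 + 1))
    + 5*c * (std_normal_density z * z ^ (2 * 2)) + 1 * (std_normal_density z * z ^ (2 * 2 + 1))
    = std_normal_density z * (c + z) ^ 5" for z
    by (simp add: algebra_simps power_numeral_reduce)
  ultimately show ?thesis by (simp add: fact_numeral algebra_simps)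
qed

lemma std_normal_abs_power5_expectation:
  "has_bochner_integral lborel (\<lambda>z. std_normal_density z * (\<bar>z\<bar> - w) ^ 5)
     (8 * sqrt (2/pi) - 15*w + 20 * sqrt (2/pi)*w^2 - 10*w^3 + 5 * sqrt (2/pi)*w^4 - w^5)"
proof -
  note e = std_normal_moment_even and o = std_normal_moment_abs_odd
  have "has_bochner_integral lborel (\<lambda>z.
      (-(w^5)) * (std_normal_density z * z ^ (2 * 0)) + 5*w^4 * (std_normal_density z * \<bar>z\<bar> ^ (2 * 0 + 1))
    + (-10*w^3) * (std_normal_density z * z ^ (2 * 1)) + 10*w^2 * (std_normal_density z * \<bar>z\<bar> ^ (2 * 1 + 1))
    + (-5*w) * (std_normal_density z * z ^ (2 * 2)) + 1 * (std_normal_density z * \<bar>z\<bar> ^ (2 * 2 + 1)))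
    ((-(w^5)) * (fact (2 * 0) / (2^0 * fact 0)) + 5*w^4 * (sqrt (2 / pi) * 2^0 * fact 0)
     + (-10*w^3) * (fact (2 * 1) / (2^1 * fact 1)) + 10*w^2 * (sqrt (2 / pi) * 2^1 * fact 1)
     + (-5*w) * (fact (2 * 2) / (2^2 * fact 2)) + 1 * (sqrt (2 / pi) * 2^2 * fact 2))"
    by (intro has_bochner_integral_add has_bochner_integral_mult_right e o)
  moreover have "(-(w^5)) * (std_normal_density z * z ^ (2 * 0)) + 5*w^4 * (std_normal_density z * \<bar>z\<bar> ^ (2 * 0 + 1))
    + (-10*w^3) * (std_normal_density z * z ^ (2 * 1)) + 10*w^2 * (std_normal_density z * \<bar>z\<bar> ^ (2 * 1 + 1))
    + (-5*w) * (std_normal_density z * z ^ (2 * 2)) + 1 * (std_normal_density z * \<bar>z\<bar> ^ (2 * 2 + 1))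
    = std_normal_density z * (\<bar>z\<bar> - w) ^ 5" for z
  proof -
    define u where "u = \<bar>z\<bar>"
    have "z ^ (2 * k) = u ^ (2 * k)" for k by (simp only: u_def power_mult power2_abs)
    thus ?thesis unfolding u_def[symmetric] by (simp only:) (simp add: algebra_simps power_numeral_reduce)
  qed
  ultimately show ?thesis by (simp add: fact_numeral algebra_simps)
qed

lemma gauss_pos5_decomp:
  "gauss_pos5 c 1 = c^5 + 10*c^3 + 15*c + gauss_pos5 (- c) 1"
proof -
  have *: "std_normal_density z * pos5 (c + 1 * z)
      = std_normal_density z * (c + z)^5 + std_normal_density z * pos5 (- c + (-1) * z)" for z
    using pos5_minus[of "c + z"] by (simp add: distrib_left[symmetric])
  have "gauss_pos5 c 1 = (\<integral>z. std_normal_density z * (c + z)^5 \<partial>lborel) + gauss_pos5 (- c) (-1)"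
    unfolding gauss_pos5_def *
    using std_normal_power5_expectation[of c] integrable_std_normal_pos5[of "-c" "-1"]
    by (intro Bochner_Integration.integral_add) (auto simp: has_bochner_integral_iff)
  thus ?thesis using std_normal_power5_expectation[of c]
    by (simp add: gauss_pos5_minus has_bochner_integral_iff)
qed

text \<open>\<open>\<bar>z\<bar> - w\<close> is one of \<open>z - w\<close> and
  \<open>- z - w\<close>, so its fifth power is at most the sum of both truncated powers. By
  symmetry these have the same expectation, which gives the factor one half.\<close>

lemma gauss_pos5_ge_abs:
  "4 * sqrt (2/pi) - 15/2*w + 10 * sqrt (2/pi)*w^2 - 5*w^3 + 5/2 * sqrt (2/pi)*w^4 - w^5/2 \<le> gauss_pos5 (- w) 1"
proof -
  have "(\<integral>z. std_normal_density z * (\<bar>z\<bar> - w) ^ 5 \<partial>lborel)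
     \<le> (\<integral>z. std_normal_density z * pos5 (- w + 1 * z) + std_normal_density z * pos5 (- w + (-1) * z) \<partial>lborel)"
  proof (intro Bochner_Integration.integral_mono)
    show "integrable lborel (\<lambda>z. std_normal_density z * (\<bar>z\<bar> - w) ^ 5)"
      using std_normal_abs_power5_expectation by (auto simp: has_bochner_integral_iff)
    show "integrable lborel (\<lambda>z. std_normal_density z * pos5 (- w + 1 * z) + std_normal_density z * pos5 (- w + (-1) * z))"
      by (intro Bochner_Integration.integrable_add integrable_std_normal_pos5)
    fix z :: real
    have "(\<bar>z\<bar> - w)^5 \<le> pos5 (- w + 1 * z) + pos5 (- w + (-1) * z)"
    proof -
      have "\<bar>z\<bar> - w = - w + 1 * z \<or> \<bar>z\<bar> - w = - w + (-1) * z" by linarith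
      hence "pos5 (\<bar>z\<bar> - w) \<le> pos5 (- w + 1 * z) + pos5 (- w + (-1) * z)"
        using pos5_nonneg[of "- w + 1 * z"] pos5_nonneg[of "- w + (-1) * z"]
        by (metis add_increasing add_increasing2 order_refl)
      thus ?thesis using power5_le_pos5[of "\<bar>z\<bar> - w"] by linarith
    qed
    thus "std_normal_density z * (\<bar>z\<bar> - w) ^ 5
      \<le> std_normal_density z * pos5 (- w + 1 * z) + std_normal_density z * pos5 (- w + (-1) * z)"
      unfolding distrib_left[symmetric] by (intro mult_left_mono) simp_all
  qed
  also have "\<dots> = gauss_pos5 (- w) 1 + gauss_pos5 (- w) (-1)"
    unfolding gauss_pos5_def
    by (intro Bochner_Integration.integral_add integrable_std_normal_pos5)
  also have "\<dots> = 2 * gauss_pos5 (- w) 1" by (simp add: gauss_pos5_minus)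
  finally show ?thesis using std_normal_abs_power5_expectation[of w]
    by (simp add: has_bochner_integral_iff)
qed

lemma sqrt_2_div_pi_ge: "797/1000 \<le> sqrt (2/pi)"
proof (rule real_le_rsqrt)
  have "pi \<le> 2 / (797/1000)\<^sup>2" using pi_approx by (simp add: power2_eq_square abs_le_iff)
  thus "(797/1000)\<^sup>2 \<le> 2 / pi" by (simp add: field_simps power2_eq_square)
qed

text \<open>For these \<open>w\<close> the integral is cut to \<open>[w, 3]\<close>, where the
  density is at least its value at 3, giving a multiple of \<open>(3 - w) ^ 6\<close>. Since
  \<open>1 \<le> w\<close>, this is at least \<open>64 * (2 - w) ^ 6\<close> times that
  multiple.\<close>

lemma gauss_pos5_ge_right:
  assumes "1 \<le> w" "w \<le> 2"
  shows "3125/93312 * (2 - w) ^ 6 \<le> gauss_pos5 (- w) 1"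
proof -
  have dens3: "3125/93312 * 6 / 64 \<le> std_normal_density 3"
  proof -
    have "exp (9/2 :: real) ^ 2 \<le> 91^2"
    proof -
      have "exp (9/2 :: real) ^ 2 = exp 1 ^ 9" by (simp add: exp_of_nat_mult[symmetric])
      also have "\<dots> \<le> (272/100)^9" using e_less_272 by (intro power_mono) auto
      also have "\<dots> \<le> 91^2" by (simp add: power_numeral_reduce)
      finally show ?thesis .
    qed
    hence e: "exp (9/2 :: real) \<le> 91" by (rule power2_le_imp_le) simp
    have "sqrt (2 * pi) \<le> sqrt (3^2)" using pi_less_4 by (intro real_sqrt_le_mono) simp
    hence "sqrt (2 * pi) * exp (9/2) \<le> 3 * 91" using e by (intro mult_mono) auto
    hence "1 / (3 * 91) \<le> 1 / (sqrt (2 * pi) * exp (9/2))" by (intro divide_left_mono) auto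
    also have "\<dots> = std_normal_density 3" by (simp add: std_normal_density_def exp_minus field_simps)
    finally show ?thesis by simp
  qed
  have int: "has_bochner_integral lborel (\<lambda>z. (z - w)^5 * indicator {w..3} z) ((3 - w)^6 / 6 - (w - w)^6/6)"
    using assms by (intro has_bochner_integral_FTC_Icc_real) (auto intro!: derivative_eq_intros continuous_intros)
  have "std_normal_density 3 * ((3 - w)^6 / 6)
      = (\<integral>z. std_normal_density 3 * ((z - w)^5 * indicator {w..3} z) \<partial>lborel)"
    using int by (simp add: has_bochner_integral_iff)
  also have "\<dots> \<le> gauss_pos5 (- w) 1" unfolding gauss_pos5_def
  proof (intro Bochner_Integration.integral_mono Bochner_Integration.integrable_mult_right integrable_std_normal_pos5)
    show "integrable lborel (\<lambda>z. (z - w)^5 * indicator {w..3} z)"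
      using int by (auto simp: has_bochner_integral_iff)
    fix z
    show "std_normal_density 3 * ((z - w)^5 * indicator {w..3} z) \<le> std_normal_density z * pos5 (- w + 1 * z)"
    proof (cases "z \<in> {w..3}")
      case True
      have "std_normal_density 3 \<le> std_normal_density z"
        using True assms power_mono[of z 3 2] unfolding std_normal_density_def by (intro mult_left_mono) auto
      thus ?thesis using True by (simp add: pos5_eq mult_right_mono)
    qed simp
  qed
  finally have *: "std_normal_density 3 * ((3 - w)^6 / 6) \<le> gauss_pos5 (- w) 1" .
  have "(2 * (2 - w)) ^ 6 \<le> (3 - w) ^ 6" using assms by (intro power_mono) auto
  hence "64 * (2 - w)^6 \<le> (3 - w)^6" unfolding power_mult_distrib by simp
  hence "(3125/93312 * 6 / 64) * (64 * (2 - w)^6 / 6) \<le> std_normal_density 3 * ((3 - w)^6 / 6)"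
    using dens3 by (intro mult_mono) auto
  thus ?thesis using * by simp
qed

lemma power5_sum: "(x + y :: real)^5 = x^5 + 5*y*x^4 + 10*y^2*x^3 + 10*y^3*x^2 + 5*y^4*x + y^5"
  by algebra

text \<open>In terms of \<open>d\<close> the atoms of \<open>Y - E Y\<close> are
  \<open>1 + d\<close> and \<open>- (1 - d)\<close>, with weights \<open>(1 - d) / 2\<close> and
  \<open>(1 + d) / 2\<close>. The bracketed combinations in the proof are twice the central moments
  of \<open>Y\<close>.\<close>

lemma two_point_power5:
  "p * (2 * (1 - p) + c)^5 + (1 - p) * (c - 2 * p)^5
    = c^5 + 10*c^3 + 15*c - skew_poly (1 - 2 * p) c"
proof -
  define d where "d = 1 - 2 * p"
  have 1: "2 * (1 - p) + c = c + (1 + d)" "c - 2 * p = c - (1 - d)" "2 * p = 1 - d" "2 * (1 - p) = 1 + d"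
    by (simp_all add: d_def)
  have 2: "(c + (1 + d))^5 = c^5 + 5*(1+d)*c^4 + 10*(1+d)^2*c^3 + 10*(1+d)^3*c^2 + 5*(1+d)^4*c + (1+d)^5"
    by (rule power5_sum)
  have 3: "(c - (1 - d))^5 = c^5 - 5*(1-d)*c^4 + 10*(1-d)^2*c^3 - 10*(1-d)^3*c^2 + 5*(1-d)^4*c - (1-d)^5"
    by algebra
  have "2 * (p * (c + (1 + d))^5 + (1 - p) * (c - (1 - d))^5)
      = 2 * p * (c + (1 + d))^5 + 2 * (1 - p) * (c - (1 - d))^5"
    by (simp only: distrib_left mult.assoc)
  also have "\<dots> = (1 - d) * (c + (1 + d))^5 + (1 + d) * (c - (1 - d))^5"
    by (simp only: 1)
  also have "\<dots> = (1 - d) * (c^5 + 5*(1+d)*c^4 + 10*(1+d)^2*c^3 + 10*(1+d)^3*c^2 + 5*(1+d)^4*c + (1+d)^5)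
     + (1 + d) * (c^5 - 5*(1-d)*c^4 + 10*(1-d)^2*c^3 - 10*(1-d)^3*c^2 + 5*(1-d)^4*c - (1-d)^5)"
    unfolding 2 3 ..
  also have "(1 - d) * (c^5 + 5*(1+d)*c^4 + 10*(1+d)^2*c^3 + 10*(1+d)^3*c^2 + 5*(1+d)^4*c + (1+d)^5)
     + (1 + d) * (c^5 - 5*(1-d)*c^4 + 10*(1-d)^2*c^3 - 10*(1-d)^3*c^2 + 5*(1-d)^4*c - (1-d)^5)
     = 2*c^5 + 10 * ((1-d)*(1+d)^2+(1+d)*(1-d)^2)*c^3 + 10*((1-d)*(1+d)^3-(1+d)*(1-d)^3)*c^2
       + 5*((1-d)*(1+d)^4+(1+d)*(1-d)^4)*c + ((1-d)*(1+d)^5-(1+d)*(1-d)^5)"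
    by (simp add: algebra_simps)
  also have "(1-d)*(1+d)^2+(1+d)*(1-d)^2 = 2 * (1 - d^2)" by algebra
  also have "(1-d)*(1+d)^3-(1+d)*(1-d)^3 = 4 * d * (1 - d^2)" by algebra
  also have "(1-d)*(1+d)^4+(1+d)*(1-d)^4 = 2 * (1 - d^2) * (1 + 3*d^2)" by algebra
  also have "(1-d)*(1+d)^5-(1+d)*(1-d)^5 = 8 * d * (1 - d^4)" by algebra
  also have "2*c^5 + 10 * (2 * (1 - d^2))*c^3 + 10*(4 * d * (1 - d^2))*c^2
       + 5*(2 * (1 - d^2) * (1 + 3*d^2))*c + 8 * d * (1 - d^4)
     = 2 * (c^5 + 10*c^3 + 15*c - skew_poly d c)"
    unfolding skew_poly_def by algebra
  finally show ?thesis unfolding 1(1,2) d_def[symmetric] by simp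
qed

text \<open>
  For \<open>w\<close> between the two atoms only the upper one contributes. Maximising over \<open>p\<close> gives
  \<open>(5/6)^5 / 12 * (2 - w)^6\<close> if \<open>-2/5 \<le> w\<close>; for smaller \<open>w\<close> the maximum \<open>- 16 * w\<close> is attained at the
  endpoint \<open>p = - w / 2\<close>.
\<close>

lemma two_point_le_gauss_std:
  assumes p: "0 \<le> p" "p \<le> 1"
  shows "p * pos5 (2 * (1 - p) - w) + (1 - p) * pos5 (- 2 * p - w) \<le> gauss_pos5 (- w) 1"
proof -
  consider "2 * (1 - p) \<le> w" | "- 2 * p < w" "w < 2 * (1 - p)" "-2/5 \<le> w"
    | "- 2 * p < w" "w < -2/5" | "w \<le> - 2 * p" by linarith
  thus ?thesis
  proof cases
    case 1
    thus ?thesis by (simp add: pos5_eq_0)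
  next
    case 2
    \<comment> \<open>The weight of the upper atom is affine in its position:
      \<open>p = (m - y) / 2\<close> with \<open>m = 2 - w\<close> and
      \<open>y = 2 * (1 - p) - w\<close>.\<close>
    have "p * pos5 (2 * (1 - p) - w) = ((2 - w) - (2 * (1 - p) - w)) / 2 * (2 * (1 - p) - w) ^ 5"
      using 2 by (simp add: pos5_eq)
    also have "\<dots> \<le> 3125/93312 * (2 - w) ^ 6"
      using 2 p by (intro power5_weight_le) auto
    also have "\<dots> \<le> gauss_pos5 (- w) 1"
    proof (cases "w \<le> 1")
      case True
      thus ?thesis using taylor_poly_ge[OF 2(3) True sqrt_2_div_pi_ge] gauss_pos5_ge_abs[of w] by linarith
    next
      case False
      thus ?thesis using 2 p by (intro gauss_pos5_ge_right) auto
    qed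
    finally show ?thesis using 2 by (simp add: pos5_eq_0)
  next
    case 3
    define c where "c = - w"
    have c: "2/5 \<le> c" "c \<le> 2 * p" using 3 by (auto simp: c_def)
    have "p * pos5 (2 * (1 - p) - w) \<le> 16 * c"
      using power5_boundary_le[OF c p(2)] p c by (simp add: pos5_eq c_def)
    also have "16 * c \<le> c^5 + 10 * c^3 + 15 * c"
    proof -
      have "1 \<le> 10 * c^2" using c power_mono[of "2/5" c 2] by (simp add: power2_eq_square)
      hence "c * 1 \<le> c * (10 * c^2)" using c by (intro mult_left_mono) auto
      moreover have "c * (10 * c^2) = 10 * c^3" by (simp add: power2_eq_square power3_eq_cube)
      ultimately show ?thesis using c zero_le_power[of c 5] by linarith
    qed
    also have "\<dots> \<le> gauss_pos5 (- w) 1"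
      using gauss_pos5_decomp[of c] by (simp add: c_def)
    finally show ?thesis using 3 by (simp add: pos5_eq_0)
  next
    case 4
    define c d where "c = - w" and "d = 1 - 2 * p"
    have cd: "2 * p \<le> c" "p = (1 - d) / 2" "1 - d \<le> c" "d \<le> 1" "0 \<le> c"
      using 4 p by (auto simp: c_def d_def field_simps)
    have "p * pos5 (2 * (1 - p) - w) + (1 - p) * pos5 (- 2 * p - w)
        = p * (2 * (1 - p) + c)^5 + (1 - p) * (c - 2 * p)^5"
    proof -
      have "2 * (1 - p) - w = 2 * (1 - p) + c" "- 2 * p - w = c - 2 * p" by (simp_all add: c_def)
      moreover have "0 \<le> 2 * (1 - p) + c" "0 \<le> c - 2 * p" using cd(1,5) p by auto
      ultimately show ?thesis by (simp only: pos5_eq)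
    qed
    also have "\<dots> = c^5 + 10*c^3 + 15*c - skew_poly d c"
      unfolding d_def by (rule two_point_power5)
    also have "\<dots> \<le> gauss_pos5 c 1"
    proof -
      \<comment> \<open>Both atoms are now in the positive range, so truncation changes only the
        normal side. Its gain has to pay for a negative \<open>skew_poly\<close>, which can occur
        only for large \<open>d\<close> and \<open>c < 2/5\<close>; there the gain is at least
        \<open>13/100\<close>.\<close>
      have "0 \<le> skew_poly d c + gauss_pos5 (- c) 1"
      proof -
        consider "d \<le> 0" | "0 < d" "d \<le> 9/20" | "9/20 \<le> d" "2/5 \<le> c" | "9/20 \<le> d" "c \<le> 2/5" by linarith
        thus ?thesis
        proof cases
          case 1
          have d2: "d^2 \<le> 1" using p cd unfolding abs_square_le_1 by auto
          hence d4: "d^4 \<le> 1" using power_mono[of "d^2" 1 2] by simp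
          have "0 \<le> 10*d^2*c^3" "0 \<le> - (20*d*(1-d^2)*c^2)" "0 \<le> (10 - 10*d^2 + 15*d^4)*c" "0 \<le> - (4*d*(1-d^4))"
            using cd d2 d4 1 by (auto simp: mult_nonneg_nonneg mult_nonpos_nonneg intro!: mult_nonpos_nonneg add_nonneg_nonneg)
          hence "0 \<le> skew_poly d c" unfolding skew_poly_def by linarith
          thus ?thesis by (simp add: add_nonneg_nonneg)
        next
          case 2
          thus ?thesis using skew_poly_small_skewness[of d c] cd by (simp add: add_nonneg_nonneg)
        next
          case 3
          thus ?thesis using skew_poly_nonneg_large[of d c] cd by (simp add: add_nonneg_nonneg)
        next
          case 4
          have "c^3 \<le> c^2" "c^5 \<le> c^4" "0 \<le> c^2" "0 \<le> c^4"
            using 4 cd power_decreasing[of 2 3 c] power_decreasing[of 4 5 c] by auto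
          moreover have "797/1000 * c^2 \<le> sqrt (2/pi) * c^2" "797/1000 * c^4 \<le> sqrt (2/pi) * c^4"
            by (intro mult_right_mono sqrt_2_div_pi_ge; simp)+
          ultimately have "13/100 \<le> gauss_pos5 (- c) 1"
            using gauss_pos5_ge_abs[of c] sqrt_2_div_pi_ge 4 by linarith
          thus ?thesis using skew_poly_ge[of d c] 4 cd by linarith
        qed
      qed
      thus ?thesis using gauss_pos5_decomp[of c] by linarith
    qed
    finally show ?thesis by (simp add: c_def)
  qed
qed

text \<open>\<open>pos5\<close> is homogeneous of degree 5, so dividing by half the distance of the
  atoms reduces to atoms that are 2 apart.\<close>

lemma two_point_le_gauss:
  assumes "0 \<le> a" "0 < b"
  shows "(b * pos5 (t - a) + a * pos5 (t + b)) / (a + b) \<le> gauss_pos5 t ((a + b) / 2)"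
proof -
  define s p where "s = (a + b) / 2" and "p = a / (a + b)"
  have s: "0 < s" and p: "0 \<le> p" "p \<le> 1" using assms by (auto simp: s_def p_def)
  have ab: "a = s * (2 * p)" "b = s * (2 * (1 - p))" using assms by (auto simp: s_def p_def field_simps)
  have 1: "pos5 (t - a) = s^5 * pos5 (- 2 * p - (- t / s))" "pos5 (t + b) = s^5 * pos5 (2 * (1 - p) - (- t / s))"
    using s by (subst pos5_mult[symmetric]; simp add: ab algebra_simps)+
  have 2: "b / (a + b) = 1 - p" "a / (a + b) = p" using assms by (auto simp: p_def field_simps)
  have "(b * pos5 (t - a) + a * pos5 (t + b)) / (a + b)
      = b / (a + b) * pos5 (t - a) + a / (a + b) * pos5 (t + b)" by (simp add: add_divide_distrib)
  also have "\<dots> = s^5 * (p * pos5 (2 * (1 - p) - (- t / s)) + (1 - p) * pos5 (- 2 * p - (- t / s)))"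
    unfolding 1 2 by (simp add: algebra_simps)
  also have "\<dots> \<le> s^5 * gauss_pos5 (- (- t / s)) 1"
    using s p by (intro mult_left_mono two_point_le_gauss_std) auto
  also have "\<dots> = gauss_pos5 t s" using gauss_pos5_scale[of s "t / s" 1] s by simp
  finally show ?thesis by (simp add: s_def)
qed

text \<open>Jensen's inequality for the convex \<open>pos5\<close>, read off from the degenerate
  two-point law with \<open>a = 0\<close>.\<close>

lemma pos5_le_gauss: "pos5 t \<le> gauss_pos5 t s"
proof (cases "s = 0")
  case True
  thus ?thesis by (simp add: gauss_pos5_def)
next
  case False
  have "pos5 t \<le> gauss_pos5 t \<bar>s\<bar>"
    using two_point_le_gauss[of 0 "2 * \<bar>s\<bar>" t] False by simp
  thus ?thesis using gauss_pos5_minus[of t s] by (cases "0 \<le> s") auto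
qed

subsection \<open>One step of the supermartingale\<close>

lemma borel_measurable_gauss_pos5 [measurable (raw)]:
  assumes [measurable]: "t \<in> borel_measurable M" "s \<in> borel_measurable M"
  shows "(\<lambda>x. gauss_pos5 (t x) (s x)) \<in> borel_measurable M"
  unfolding gauss_pos5_def by measurable

lemma nn_integral_std_normal_pos5:
  "(\<integral>\<^sup>+z. ennreal (std_normal_density z) * ennreal (pos5 (t + s * z)) \<partial>lborel) = ennreal (gauss_pos5 t s)"
  unfolding gauss_pos5_def using integrable_std_normal_pos5
  by (subst nn_integral_eq_integral[symmetric]) (auto simp: ennreal_mult)

lemma normal_density_rescale:
  assumes "0 < \<sigma>"
  shows "\<sigma> * normal_density 0 \<sigma> (\<sigma> * z) = std_normal_density z"
  using assms by (simp add: normal_density_def power_mult_distrib real_sqrt_mult field_simps)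

lemma nn_integral_normal_rescale:
  assumes [measurable]: "h \<in> borel_measurable borel" and "0 < \<sigma>"
  shows "(\<integral>\<^sup>+y. ennreal (normal_density 0 \<sigma> y) * h y \<partial>lborel)
    = (\<integral>\<^sup>+z. ennreal (std_normal_density z) * h (\<sigma> * z) \<partial>lborel)"
proof -
  have "(\<integral>\<^sup>+y. ennreal (normal_density 0 \<sigma> y) * h y \<partial>lborel)
      = ennreal \<sigma> * (\<integral>\<^sup>+z. ennreal (normal_density 0 \<sigma> (\<sigma> * z)) * h (\<sigma> * z) \<partial>lborel)"
    using assms by (subst nn_integral_real_affine[where c=\<sigma> and t=0]) auto
  also have "\<dots> = (\<integral>\<^sup>+z. ennreal \<sigma> * (ennreal (normal_density 0 \<sigma> (\<sigma> * z)) * h (\<sigma> * z)) \<partial>lborel)"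
    by (rule nn_integral_cmult[symmetric]) measurable
  also have "\<dots> = (\<integral>\<^sup>+z. ennreal (std_normal_density z) * h (\<sigma> * z) \<partial>lborel)"
    using assms by (intro nn_integral_cong)
      (simp add: normal_density_rescale[symmetric] ennreal_mult mult.assoc)
  finally show ?thesis .
qed

text \<open>A sum of independent centred normals is normal with the added variances.
  \<open>\<tau>\<close> may have any sign because it will be \<open>s_real\<close>, which is
  negative for negative \<open>B\<close>; zero values are separated since they have no
  density.\<close>

lemma gauss_pos5_convolution:
  assumes "0 \<le> \<sigma>"
  shows "(\<integral>\<^sup>+z. ennreal (std_normal_density z) * ennreal (gauss_pos5 (t + \<sigma> * z) \<tau>) \<partial>lborel)
    = ennreal (gauss_pos5 t (sqrt (\<sigma>\<^sup>2 + \<tau>\<^sup>2)))"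
proof -
  have pos: "(\<integral>\<^sup>+z. ennreal (std_normal_density z) * ennreal (gauss_pos5 (t + \<sigma> * z) \<tau>) \<partial>lborel)
    = ennreal (gauss_pos5 t (sqrt (\<sigma>\<^sup>2 + \<tau>\<^sup>2)))" if \<sigma>: "0 < \<sigma>" and \<tau>: "0 < \<tau>" for \<tau>
  proof -
    have U: "ennreal (gauss_pos5 s \<rho>) = (\<integral>\<^sup>+y. ennreal (normal_density 0 \<rho> y) * ennreal (pos5 (s + y)) \<partial>lborel)"
      if "0 < \<rho>" for s \<rho>
      using that by (subst nn_integral_normal_rescale) (auto simp: nn_integral_std_normal_pos5)
    have "(\<integral>\<^sup>+z. ennreal (std_normal_density z) * ennreal (gauss_pos5 (t + \<sigma> * z) \<tau>) \<partial>lborel)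
      = (\<integral>\<^sup>+y. ennreal (normal_density 0 \<sigma> y) * ennreal (gauss_pos5 (t + y) \<tau>) \<partial>lborel)"
      by (subst nn_integral_normal_rescale[OF _ \<sigma>]) auto
    also have "\<dots> = (\<integral>\<^sup>+y. \<integral>\<^sup>+u. ennreal (normal_density 0 \<sigma> y) *
        (ennreal (normal_density 0 \<tau> (u - y)) * ennreal (pos5 (t + u))) \<partial>lborel \<partial>lborel)"
    proof (intro nn_integral_cong)
      fix y :: real
      have "ennreal (gauss_pos5 (t + y) \<tau>)
          = (\<integral>\<^sup>+u. ennreal (normal_density 0 \<tau> (u - y)) * ennreal (pos5 (t + u)) \<partial>lborel)"
        unfolding U[OF \<tau>]
        by (subst nn_integral_real_affine[where c=1 and t="- y"]) (auto simp: algebra_simps)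
      thus "ennreal (normal_density 0 \<sigma> y) * ennreal (gauss_pos5 (t + y) \<tau>)
        = (\<integral>\<^sup>+u. ennreal (normal_density 0 \<sigma> y) *
        (ennreal (normal_density 0 \<tau> (u - y)) * ennreal (pos5 (t + u))) \<partial>lborel)"
        by (simp add: nn_integral_cmult)
    qed
    also have "\<dots> = (\<integral>\<^sup>+u. \<integral>\<^sup>+y. ennreal (normal_density 0 \<sigma> y) *
        (ennreal (normal_density 0 \<tau> (u - y)) * ennreal (pos5 (t + u))) \<partial>lborel \<partial>lborel)"
      by (rule lborel_pair.Fubini'[symmetric]) measurable
    also have "\<dots> = (\<integral>\<^sup>+u. (\<integral>\<^sup>+y. ennreal (normal_density 0 \<tau> (u - y) * normal_density 0 \<sigma> y) \<partial>lborel)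
        * ennreal (pos5 (t + u)) \<partial>lborel)"
      by (intro nn_integral_cong, subst nn_integral_multc[symmetric])
        (auto simp: ennreal_mult mult_ac intro!: nn_integral_cong)
    also have "\<dots> = (\<integral>\<^sup>+u. ennreal (normal_density 0 (sqrt (\<tau>\<^sup>2 + \<sigma>\<^sup>2)) u) * ennreal (pos5 (t + u)) \<partial>lborel)"
      using fun_cong[OF conv_normal_density_zero_mean[OF \<tau> \<sigma>]] by simp
    also have "\<dots> = ennreal (gauss_pos5 t (sqrt (\<sigma>\<^sup>2 + \<tau>\<^sup>2)))"
      using \<sigma> by (subst U) (auto simp: add.commute intro: add_pos_nonneg)
    finally show ?thesis .
  qed
  consider "\<sigma> = 0" | "0 < \<sigma>" "\<tau> = 0" | "0 < \<sigma>" "0 < \<tau>" | "0 < \<sigma>" "0 < - \<tau>" using assms by linarith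
  thus ?thesis
  proof cases
    case 1
    have "gauss_pos5 t \<bar>\<tau>\<bar> = gauss_pos5 t \<tau>" using gauss_pos5_minus[of t \<tau>] by (simp add: abs_if)
    moreover have "(\<integral>\<^sup>+z. ennreal (std_normal_density z) \<partial>lborel) = 1"
      by (subst nn_integral_eq_integral) auto
    ultimately show ?thesis using 1 by (simp add: nn_integral_multc)
  next
    case 2
    have "gauss_pos5 s 0 = pos5 s" for s by (simp add: gauss_pos5_def)
    thus ?thesis using 2 by (simp add: nn_integral_std_normal_pos5)
  next
    case 3
    thus ?thesis by (rule pos)
  next
    case 4
    thus ?thesis using pos[OF 4] by (simp add: gauss_pos5_minus)
  qed
qed

section \<open>The conditional step over a fixed sub-sigma-algebra\<close>

context finite_measure_subalgebra
begin

text \<open>The bounds by \<open>K\<close> make every term integrable although \<open>X\<close>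
  itself may have infinite second moment: \<open>c2\<close> vanishes wherever \<open>C\<close>
  exceeds \<open>K\<close>. This also keeps \<open>enn2real\<close> away from the value infinity,
  which it would send to 0.\<close>

lemma quadratic_cond_exp_le:
  fixes X c0 c1 c2 :: "'a \<Rightarrow> real" and K :: real
  defines "C \<equiv> nn_cond_exp M F (\<lambda>\<omega>. ennreal ((X \<omega>)\<^sup>2))"
  assumes X: "integrable M X" and EX: "AE \<omega> in M. real_cond_exp M F X \<omega> \<le> 0"
    and meas [measurable]: "c0 \<in> borel_measurable F" "c1 \<in> borel_measurable F" "c2 \<in> borel_measurable F"
    and bounds: "\<And>\<omega>. \<bar>c0 \<omega>\<bar> \<le> K" "\<And>\<omega>. 0 \<le> c1 \<omega>" "\<And>\<omega>. c1 \<omega> \<le> K" "\<And>\<omega>. 0 \<le> c2 \<omega>" "\<And>\<omega>. c2 \<omega> \<le> K"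
    and C: "\<And>\<omega>. c2 \<omega> \<noteq> 0 \<Longrightarrow> C \<omega> \<le> ennreal K"
  shows "integrable M (\<lambda>\<omega>. c0 \<omega> + c1 \<omega> * X \<omega> + c2 \<omega> * (X \<omega>)\<^sup>2)"
    and "integrable M (\<lambda>\<omega>. c0 \<omega> + c2 \<omega> * enn2real (C \<omega>))"
    and "(\<integral>\<omega>. c0 \<omega> + c1 \<omega> * X \<omega> + c2 \<omega> * (X \<omega>)\<^sup>2 \<partial>M) \<le> (\<integral>\<omega>. c0 \<omega> + c2 \<omega> * enn2real (C \<omega>) \<partial>M)"
proof -
  note [measurable] = borel_measurable_integrable[OF X]
  have mM [measurable]: "c0 \<in> borel_measurable M" "c1 \<in> borel_measurable M" "c2 \<in> borel_measurable M"
    using meas by (auto intro: measurable_from_subalg[OF subalg])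
  have CF [measurable]: "C \<in> borel_measurable F" unfolding C_def by (rule borel_measurable_nn_cond_exp)
  have CM [measurable]: "C \<in> borel_measurable M" by (rule measurable_from_subalg[OF subalg CF])
  have K: "0 \<le> K" using order_trans[OF bounds(2,3)] .
  have i0: "integrable M c0"
    by (rule integrable_const_bound[of _ K]) (use bounds in auto)
  have i1: "integrable M (\<lambda>\<omega>. c1 \<omega> * X \<omega>)"
    by (rule Bochner_Integration.integrable_bound[of _ "\<lambda>\<omega>. K * X \<omega>"])
      (use X K bounds in \<open>auto simp: abs_mult intro!: mult_right_mono\<close>)
  have i2': "integrable M (\<lambda>\<omega>. c2 \<omega> * enn2real (C \<omega>))"
  proof (rule integrable_const_bound[of _ "K * K"])
    have "c2 \<omega> * enn2real (C \<omega>) \<le> K * K" for \<omega>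
    proof (cases "c2 \<omega> = 0")
      case False
      have "enn2real (C \<omega>) \<le> K" using C[OF False] K by (rule enn2real_leI[rotated])
      thus ?thesis using bounds K by (intro mult_mono) auto
    qed (use K in simp)
    thus "AE \<omega> in M. norm (c2 \<omega> * enn2real (C \<omega>)) \<le> K * K"
      using bounds by simp
  qed measurable
  have nn: "(\<integral>\<^sup>+\<omega>. ennreal (c2 \<omega> * (X \<omega>)\<^sup>2) \<partial>M) = (\<integral>\<^sup>+\<omega>. ennreal (c2 \<omega> * enn2real (C \<omega>)) \<partial>M)"
  proof -
    have "(\<integral>\<^sup>+\<omega>. ennreal (c2 \<omega> * (X \<omega>)\<^sup>2) \<partial>M) = (\<integral>\<^sup>+\<omega>. ennreal (c2 \<omega>) * ennreal ((X \<omega>)\<^sup>2) \<partial>M)"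
      using bounds by (simp add: ennreal_mult)
    also have "\<dots> = (\<integral>\<^sup>+\<omega>. ennreal (c2 \<omega>) * C \<omega> \<partial>M)"
      unfolding C_def by (rule nn_cond_exp_intg[symmetric]) measurable
    also have "\<dots> = (\<integral>\<^sup>+\<omega>. ennreal (c2 \<omega> * enn2real (C \<omega>)) \<partial>M)"
    proof (rule nn_integral_cong)
      fix \<omega>
      show "ennreal (c2 \<omega>) * C \<omega> = ennreal (c2 \<omega> * enn2real (C \<omega>))"
      proof (cases "c2 \<omega> = 0")
        case False
        have "C \<omega> < \<top>" using le_less_trans[OF C[OF False] ennreal_less_top] .
        thus ?thesis using bounds by (simp add: ennreal_mult)
      qed simp
    qed
    finally show ?thesis .
  qed
  have i2: "integrable M (\<lambda>\<omega>. c2 \<omega> * (X \<omega>)\<^sup>2)"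
  proof (rule integrableI_nonneg)
    show "(\<integral>\<^sup>+\<omega>. ennreal (c2 \<omega> * (X \<omega>)\<^sup>2) \<partial>M) < \<infinity>"
      unfolding nn using i2' bounds by (subst nn_integral_eq_integral) auto
  qed (use bounds in auto)
  have e2: "(\<integral>\<omega>. c2 \<omega> * (X \<omega>)\<^sup>2 \<partial>M) = (\<integral>\<omega>. c2 \<omega> * enn2real (C \<omega>) \<partial>M)"
    using nn bounds by (simp add: integral_eq_nn_integral)
  have e1: "(\<integral>\<omega>. c1 \<omega> * X \<omega> \<partial>M) \<le> 0"
  proof -
    have "(\<integral>\<omega>. c1 \<omega> * X \<omega> \<partial>M) = (\<integral>\<omega>. c1 \<omega> * real_cond_exp M F X \<omega> \<partial>M)"
      by (rule real_cond_exp_intg(2)[symmetric]) (use i1 in measurable)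
    also have "\<dots> \<le> (\<integral>\<omega>. 0 \<partial>M)"
      using EX bounds by (intro integral_mono_AE real_cond_exp_intg(1) i1)
        (auto intro: mult_nonneg_nonpos)
    finally show ?thesis by simp
  qed
  show "integrable M (\<lambda>\<omega>. c0 \<omega> + c1 \<omega> * X \<omega> + c2 \<omega> * (X \<omega>)\<^sup>2)"
    using i0 i1 i2 by simp
  show "integrable M (\<lambda>\<omega>. c0 \<omega> + c2 \<omega> * enn2real (C \<omega>))"
    using i0 i2' by simp
  show "(\<integral>\<omega>. c0 \<omega> + c1 \<omega> * X \<omega> + c2 \<omega> * (X \<omega>)\<^sup>2 \<partial>M) \<le> (\<integral>\<omega>. c0 \<omega> + c2 \<omega> * enn2real (C \<omega>) \<partial>M)"
    using i0 i1 i2 i2' e1 e2 by simp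
qed

lemma pos5_one_step:
  fixes X B T :: "'a \<Rightarrow> real"
  defines "C \<equiv> nn_cond_exp M F (\<lambda>\<omega>. ennreal ((X \<omega>)\<^sup>2))"
  assumes X: "integrable M X" and EX: "AE \<omega> in M. real_cond_exp M F X \<omega> \<le> 0"
    and meas [measurable]: "T \<in> borel_measurable F" "B \<in> borel_measurable F" "G \<in> sets F"
    and XB: "AE \<omega> in M. X \<omega> \<le> B \<omega>"
    and G: "AE \<omega> in M. \<omega> \<in> G \<longrightarrow> C \<omega> < \<infinity> \<and> B \<omega> \<noteq> 0"
  shows "(\<integral>\<^sup>+\<omega>\<in>G. ennreal (pos5 (T \<omega> + X \<omega>)) \<partial>M)
    \<le> (\<integral>\<^sup>+\<omega>\<in>G. ennreal (gauss_pos5 (T \<omega>) ((B \<omega> + enn2real (C \<omega>) / B \<omega>) / 2)) \<partial>M)"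
proof -
  note [measurable] = borel_measurable_integrable[OF X]
  have CF [measurable]: "C \<in> borel_measurable F" unfolding C_def by (rule borel_measurable_nn_cond_exp)
  have mM [measurable]: "C \<in> borel_measurable M" "T \<in> borel_measurable M" "B \<in> borel_measurable M" "G \<in> sets M"
    using CF meas subalg by (auto intro: measurable_from_subalg simp: subalgebra_def)
  define a where "a \<omega> = enn2real (C \<omega>) / B \<omega>" for \<omega>
  \<comment> \<open>Where \<open>B\<close> is not positive, \<open>X \<le> B\<close> already gives
    \<open>pos5 (T + X) \<le> pos5 T\<close>, and the parabola degenerates to a constant.\<close>
  define c0 where "c0 \<omega> = (if 0 < B \<omega> then majorant0 (T \<omega>) (a \<omega>) (B \<omega>) else pos5 (T \<omega>))" for \<omega>
  define c1 where "c1 \<omega> = (if 0 < B \<omega> then majorant1 (T \<omega>) (a \<omega>) (B \<omega>) else 0)" for \<omega>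
  define c2 where "c2 \<omega> = (if 0 < B \<omega> then majorant2 (T \<omega>) (a \<omega>) (B \<omega>) else 0)" for \<omega>
  define U where "U \<omega> = gauss_pos5 (T \<omega>) ((B \<omega> + enn2real (C \<omega>) / B \<omega>) / 2)" for \<omega>
  have cF [measurable]: "a \<in> borel_measurable F" "c0 \<in> borel_measurable F" "c1 \<in> borel_measurable F" "c2 \<in> borel_measurable F"
    unfolding a_def c0_def c1_def c2_def by measurable
  have UM [measurable]: "U \<in> borel_measurable M" unfolding U_def by measurable
  have a: "0 < B \<omega> \<Longrightarrow> 0 \<le> a \<omega>" for \<omega> by (simp add: a_def)
  have c1: "0 \<le> c1 \<omega>" and c2: "0 \<le> c2 \<omega>" for \<omega>
    using a by (auto simp: c1_def c2_def majorant1_nonneg majorant2_nonneg)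
  have upper: "pos5 (T \<omega> + X \<omega>) \<le> c0 \<omega> + c1 \<omega> * X \<omega> + c2 \<omega> * (X \<omega>)\<^sup>2" if "X \<omega> \<le> B \<omega>" for \<omega>
    using that a pos5_le_majorant[of "a \<omega>" "B \<omega>" "X \<omega>" "T \<omega>"]
    by (auto simp: c0_def c1_def c2_def intro: pos5_mono)
  \<comment> \<open>The lower atom \<open>- a\<close> was chosen so that \<open>a * B\<close> equals
    the conditional second moment.\<close>
  have two: "c0 \<omega> + c2 \<omega> * enn2real (C \<omega>) = (B \<omega> * pos5 (T \<omega> - a \<omega>) + a \<omega> * pos5 (T \<omega> + B \<omega>)) / (a \<omega> + B \<omega>)"
    if "0 < B \<omega>" for \<omega>
    using majorant_two_point[OF a[OF that] that, of "T \<omega>"] that by (simp add: c0_def c2_def a_def)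
  have lower: "0 \<le> c0 \<omega> + c2 \<omega> * enn2real (C \<omega>)" for \<omega>
    using a[of \<omega>] two[of \<omega>] by (cases "0 < B \<omega>") (auto simp: c0_def c2_def)
  have dom: "c0 \<omega> + c2 \<omega> * enn2real (C \<omega>) \<le> U \<omega>" for \<omega>
  proof (cases "0 < B \<omega>")
    case True
    thus ?thesis using two_point_le_gauss[OF a[OF True] True, of "T \<omega>"] two[OF True]
      by (simp add: U_def a_def add.commute)
  next
    case False
    thus ?thesis by (simp add: c0_def c2_def U_def pos5_le_gauss)
  qed
  \<comment> \<open>These sets make the coefficients and \<open>C\<close> bounded. They increase to
    \<open>G\<close> up to a null set, because \<open>C\<close> is almost surely finite on
    \<open>G\<close>.\<close>
  define Gm where "Gm m = {\<omega> \<in> space F. \<omega> \<in> G \<and> C \<omega> \<le> ennreal (real m) \<and> \<bar>c0 \<omega>\<bar> + c1 \<omega> + c2 \<omega> \<le> real m}" for m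
  have GmF [measurable]: "Gm m \<in> sets F" for m unfolding Gm_def by measurable
  have GmM [measurable]: "Gm m \<in> sets M" for m using GmF subalg by (auto simp: subalgebra_def)
  have step: "(\<integral>\<^sup>+\<omega>\<in>Gm m. ennreal (pos5 (T \<omega> + X \<omega>)) \<partial>M) \<le> (\<integral>\<^sup>+\<omega>\<in>G. ennreal (U \<omega>) \<partial>M)" for m
  proof -
    define I where "I \<omega> = (indicator (Gm m) \<omega> :: real)" for \<omega>
    have [measurable]: "I \<in> borel_measurable F" unfolding I_def by measurable
    define W where "W \<omega> = I \<omega> * c0 \<omega> + (I \<omega> * c1 \<omega>) * X \<omega> + (I \<omega> * c2 \<omega>) * (X \<omega>)\<^sup>2" for \<omega>
    have "\<bar>I \<omega> * c0 \<omega>\<bar> \<le> real m" "I \<omega> * c1 \<omega> \<le> real m" "I \<omega> * c2 \<omega> \<le> real m" for \<omega>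
      using c1[of \<omega>] c2[of \<omega>] by (auto simp: I_def Gm_def indicator_def)
    moreover have "I \<omega> * c2 \<omega> \<noteq> 0 \<Longrightarrow> C \<omega> \<le> ennreal (real m)" for \<omega>
      by (auto simp: I_def Gm_def indicator_def)
    ultimately have q: "integrable M W" "integrable M (\<lambda>\<omega>. I \<omega> * c0 \<omega> + (I \<omega> * c2 \<omega>) * enn2real (C \<omega>))"
      "(\<integral>\<omega>. W \<omega> \<partial>M) \<le> (\<integral>\<omega>. I \<omega> * c0 \<omega> + (I \<omega> * c2 \<omega>) * enn2real (C \<omega>) \<partial>M)"
      using quadratic_cond_exp_le[OF X EX, of "\<lambda>\<omega>. I \<omega> * c0 \<omega>" "\<lambda>\<omega>. I \<omega> * c1 \<omega>" "\<lambda>\<omega>. I \<omega> * c2 \<omega>" "real m"]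
        c1 c2 unfolding W_def C_def[symmetric] by (auto simp: I_def)
    have W: "W \<omega> = I \<omega> * (c0 \<omega> + c1 \<omega> * X \<omega> + c2 \<omega> * (X \<omega>)\<^sup>2)" for \<omega>
      by (simp add: W_def algebra_simps)
    have up: "AE \<omega> in M. I \<omega> * pos5 (T \<omega> + X \<omega>) \<le> W \<omega>"
      using XB by eventually_elim (auto simp: W I_def intro!: mult_left_mono upper)
    have "(\<integral>\<^sup>+\<omega>\<in>Gm m. ennreal (pos5 (T \<omega> + X \<omega>)) \<partial>M) = (\<integral>\<^sup>+\<omega>. ennreal (I \<omega> * pos5 (T \<omega> + X \<omega>)) \<partial>M)"
      by (intro nn_integral_cong) (auto simp: I_def indicator_def)
    also have "\<dots> \<le> (\<integral>\<^sup>+\<omega>. ennreal (W \<omega>) \<partial>M)"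
      using up by (intro nn_integral_mono_AE) (auto intro: ennreal_leI)
    also have "\<dots> = ennreal (\<integral>\<omega>. W \<omega> \<partial>M)"
    proof (rule nn_integral_eq_integral[OF q(1)])
      show "AE \<omega> in M. 0 \<le> W \<omega>" using up
        by eventually_elim (rule order_trans[rotated], auto simp: I_def)
    qed
    also have "\<dots> \<le> ennreal (\<integral>\<omega>. I \<omega> * c0 \<omega> + (I \<omega> * c2 \<omega>) * enn2real (C \<omega>) \<partial>M)"
      using q(3) by (rule ennreal_leI)
    also have "\<dots> = (\<integral>\<^sup>+\<omega>. ennreal (I \<omega> * c0 \<omega> + (I \<omega> * c2 \<omega>) * enn2real (C \<omega>)) \<partial>M)"
      using lower by (intro nn_integral_eq_integral[symmetric] q(2))
        (auto simp: I_def indicator_def)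
    also have "\<dots> \<le> (\<integral>\<^sup>+\<omega>\<in>G. ennreal (U \<omega>) \<partial>M)"
      using dom by (intro nn_integral_mono) (auto simp: I_def Gm_def indicator_def intro: ennreal_leI)
    finally show ?thesis .
  qed
  have "(\<integral>\<^sup>+\<omega>\<in>G. ennreal (pos5 (T \<omega> + X \<omega>)) \<partial>M)
      = (\<integral>\<^sup>+\<omega>. (SUP m. ennreal (pos5 (T \<omega> + X \<omega>)) * indicator (Gm m) \<omega>) \<partial>M)"
  proof (rule nn_integral_cong_AE)
    show "AE \<omega> in M. ennreal (pos5 (T \<omega> + X \<omega>)) * indicator G \<omega>
        = (SUP m. ennreal (pos5 (T \<omega> + X \<omega>)) * indicator (Gm m) \<omega>)"
      using G AE_space
    proof eventually_elim
      case (elim \<omega>)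
      show ?case
      proof (cases "\<omega> \<in> G")
        case True
        obtain m :: nat where m: "max (enn2real (C \<omega>)) (\<bar>c0 \<omega>\<bar> + c1 \<omega> + c2 \<omega>) \<le> real m"
          using real_arch_simple by blast
        have "C \<omega> = ennreal (enn2real (C \<omega>))" using elim True by simp
        hence "C \<omega> \<le> ennreal (real m)" using m by (metis ennreal_leI max.boundedE)
        hence "\<omega> \<in> Gm m" using m True elim subalg by (auto simp: Gm_def subalgebra_def)
        hence "ennreal (pos5 (T \<omega> + X \<omega>)) * indicator G \<omega> \<le> (SUP m. ennreal (pos5 (T \<omega> + X \<omega>)) * indicator (Gm m) \<omega>)"
          using True by (intro SUP_upper2[of m]) auto
        moreover have "(SUP m. ennreal (pos5 (T \<omega> + X \<omega>)) * indicator (Gm m) \<omega>) \<le> ennreal (pos5 (T \<omega> + X \<omega>)) * indicator G \<omega>"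
          using True by (intro SUP_least) (auto simp: indicator_def)
        ultimately show ?thesis by (rule antisym)
      next
        case False
        thus ?thesis by (simp add: Gm_def)
      qed
    qed
  qed
  also have "\<dots> = (SUP m. \<integral>\<^sup>+\<omega>\<in>Gm m. ennreal (pos5 (T \<omega> + X \<omega>)) \<partial>M)"
  proof (rule nn_integral_monotone_convergence_SUP)
    show "incseq (\<lambda>m \<omega>. ennreal (pos5 (T \<omega> + X \<omega>)) * indicator (Gm m) \<omega>)"
    proof (intro incseq_SucI le_funI mult_left_mono)
      fix m \<omega>
      have "Gm m \<subseteq> Gm (Suc m)" unfolding Gm_def by (auto intro: order_trans ennreal_leI)
      thus "indicator (Gm m) \<omega> \<le> (indicator (Gm (Suc m)) \<omega> :: ennreal)" by (rule indicator_leI[OF subsetD])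
    qed auto
  qed measurable
  also have "\<dots> \<le> (\<integral>\<^sup>+\<omega>\<in>G. ennreal (U \<omega>) \<partial>M)" by (intro SUP_least step)
  finally show ?thesis unfolding U_def .
qed

end

subsection \<open>The Gaussian tail\<close>

lemma std_normal_density_ratio:
  "std_normal_density z = std_normal_density x * exp (- ((z\<^sup>2 - x\<^sup>2) / 2))"
  by (simp add: std_normal_density_def exp_add[symmetric] field_simps)

definition gauss_tail :: "real \<Rightarrow> real" where
  "gauss_tail x = (\<integral>z. std_normal_density z * indicator {x..} z \<partial>lborel)"

lemma integrable_std_normal_indicator:
  "integrable lborel (\<lambda>z. std_normal_density z * indicator {x::real..} z)"
  by (rule integrable_real_mult_indicator) auto

lemma gauss_tail_pos:
  assumes "0 \<le> x"
  shows "0 < gauss_tail x"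
proof -
  have "0 < std_normal_density (x + 1)" by (simp add: normal_density_pos)
  also have "\<dots> = (\<integral>z. std_normal_density (x + 1) * indicator {x..x+1} z \<partial>lborel)" by simp
  also have "\<dots> \<le> gauss_tail x" unfolding gauss_tail_def
  proof (intro Bochner_Integration.integral_mono integrable_std_normal_indicator)
    show "integrable lborel (\<lambda>z. std_normal_density (x + 1) * indicator {x..x+1} z)" by simp
    fix z
    show "std_normal_density (x + 1) * indicator {x..x+1} z \<le> std_normal_density z * indicator {x..} z"
    proof (cases "z \<in> {x..x+1}")
      case True
      hence "z\<^sup>2 \<le> (x + 1)\<^sup>2" using assms by (intro power_mono) auto
      hence "std_normal_density (x + 1) \<le> std_normal_density z"
        unfolding std_normal_density_def by (intro mult_left_mono) auto
      thus ?thesis using True by simp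
    qed (simp add: indicator_def)
  qed
  finally show ?thesis .
qed

text \<open>On \<open>[x, \<infinity>)\<close> the factor \<open>x\<close> is at most
  \<open>z\<close>, and \<open>z * std_normal_density z\<close> is the derivative of
  \<open>- std_normal_density z\<close>. It shows below that the hazard rate is at least
  \<open>x\<close>.\<close>

lemma mills_ratio:
  assumes "0 \<le> x"
  shows "x * gauss_tail x \<le> std_normal_density x"
proof -
  have "ennreal (x * gauss_tail x) = (\<integral>\<^sup>+z. ennreal (x * (std_normal_density z * indicator {x..} z)) \<partial>lborel)"
    unfolding gauss_tail_def using assms integrable_std_normal_indicator[of x]
    by (subst nn_integral_eq_integral) auto
  also have "\<dots> \<le> (\<integral>\<^sup>+z\<in>{x..}. ennreal (z * std_normal_density z) \<partial>lborel)"
    using assms by (intro nn_integral_mono) (auto simp: indicator_def intro!: mult_right_mono)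
  also have "\<dots> = ennreal (0 - (- std_normal_density x))"
  proof (rule nn_integral_FTC_atLeast)
    show "(\<lambda>z. z * std_normal_density z) \<in> borel_measurable borel" by measurable
    show "((\<lambda>z. - std_normal_density z) has_real_derivative z * std_normal_density z) (at z)" for z
      unfolding std_normal_density_def by (auto intro!: derivative_eq_intros simp: field_simps)
    show "0 \<le> z * std_normal_density z" if "x \<le> z" for z using that assms by simp
    show "((\<lambda>z. - std_normal_density z) \<longlongrightarrow> 0) at_top"
      unfolding std_normal_density_def by real_asymp
  qed
  finally show ?thesis by (simp add: ennreal_le_iff)
qed

lemma has_bochner_integral_power_exp:
  "has_bochner_integral lborel (\<lambda>y::real. y ^ k * exp (- y) * indicator {0..} y) (fact k)"
proof (rule has_bochner_integral_nn_integral)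
  show "(\<integral>\<^sup>+ y. ennreal (y ^ k * exp (- y) * indicator {0..} y) \<partial>lborel) = ennreal (fact k)"
    using nn_intergal_power_times_exp_Ici[of k] by (simp add: ennreal_mult'' ennreal_indicator[symmetric] del: ennreal_indicator)
qed (auto simp: indicator_def)

text \<open>
  With \<open>\<mu>\<close> the hazard rate at \<open>x\<close>, the exponential density \<open>k\<close> agrees with the normal density \<open>\<phi>\<close> at
  \<open>x\<close> and has the same mass on \<open>[x, \<infinity>)\<close>. Since \<open>k - \<phi>\<close> is nonnegative before \<open>x\<close> and changes sign from
  minus to plus at \<open>z0 = 2 * \<mu> - x\<close> after it, the increasing function \<open>g\<close> has the larger integral
  against \<open>k\<close>, where it is a Gamma integral.
\<close>

lemma gauss_pos5_le_tail:
  assumes x: "0 \<le> x"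
  shows "\<exists>\<mu>>0. gauss_pos5 (1 - \<mu> / 5 * x) (\<mu> / 5) \<le> fact 5 * (exp 1 / 5) ^ 5 * gauss_tail x"
proof (intro exI conjI)
  define \<mu> where "\<mu> = std_normal_density x / gauss_tail x"
  have Q: "0 < gauss_tail x" by (rule gauss_tail_pos[OF x])
  show mu: "0 < \<mu>" using Q by (simp add: \<mu>_def normal_density_pos)
  have mux: "x \<le> \<mu>" using mills_ratio[OF x] Q by (simp add: \<mu>_def field_simps)
  have phi: "std_normal_density x = \<mu> * gauss_tail x" using Q by (simp add: \<mu>_def)
  define k where "k z = std_normal_density x * exp (- (\<mu> * (z - x)))" for z
  define g where "g z = pos5 (1 - \<mu> / 5 * x + \<mu> / 5 * z)" for z
  define z0 where "z0 = 2 * \<mu> - x"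
  have sgn: "std_normal_density z \<le> k z \<longleftrightarrow> 0 \<le> (z - x) * (z - z0)" for z
  proof -
    have "std_normal_density z \<le> k z \<longleftrightarrow> - ((z\<^sup>2 - x\<^sup>2) / 2) \<le> - (\<mu> * (z - x))"
      unfolding k_def by (subst std_normal_density_ratio[of z x]) (simp add: normal_density_pos)
    also have "\<dots> \<longleftrightarrow> 0 \<le> (z - x) * (z - z0)"
    proof -
      have "(z - x) * (z - z0) = 2 * ((z\<^sup>2 - x\<^sup>2) / 2 - \<mu> * (z - x))"
        by (simp add: z0_def power2_eq_square field_simps)
      thus ?thesis by argo
    qed
    finally show ?thesis .
  qed
  have gmono: "g z \<le> g z'" if "z \<le> z'" for z z'
    unfolding g_def using that mu by (intro pos5_mono) auto
  \<comment> \<open>With \<open>y = 5 - \<mu> * x + \<mu> * z\<close> one has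
    \<open>g z = pos5 (y / 5)\<close> and \<open>k z = std_normal_density x * exp (5 - y)\<close>.
    The Gamma integral gives \<open>fact 5\<close>, the shift gives \<open>exp 1 ^ 5\<close>, and
    dividing by \<open>\<mu>\<close> turns the density at \<open>x\<close> into the tail.\<close>
  have gk: "has_bochner_integral lborel (\<lambda>z. g z * k z) (fact 5 * (exp 1 / 5) ^ 5 * gauss_tail x)"
  proof -
    have "has_bochner_integral lborel
      (\<lambda>z. (5 - \<mu> * x + \<mu> * z) ^ 5 * exp (- (5 - \<mu> * x + \<mu> * z)) * indicator {0..} (5 - \<mu> * x + \<mu> * z)) (fact 5 /\<^sub>R \<bar>\<mu>\<bar>)"
      using has_bochner_integral_power_exp[of 5] mu by (subst (asm) lborel_has_bochner_integral_real_affine_iff[of \<mu> _ _ "5 - \<mu> * x"]) auto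
    hence "has_bochner_integral lborel (\<lambda>z. std_normal_density x * (exp 1 / 5)^5 *
      ((5 - \<mu> * x + \<mu> * z) ^ 5 * exp (- (5 - \<mu> * x + \<mu> * z)) * indicator {0..} (5 - \<mu> * x + \<mu> * z)))
      (std_normal_density x * (exp 1 / 5)^5 * (fact 5 /\<^sub>R \<bar>\<mu>\<bar>))"
      by (rule has_bochner_integral_mult_right)
    moreover have "std_normal_density x * (exp 1 / 5)^5 *
      ((5 - \<mu> * x + \<mu> * z) ^ 5 * exp (- (5 - \<mu> * x + \<mu> * z)) * indicator {0..} (5 - \<mu> * x + \<mu> * z))
      = g z * k z" for z
    proof -
      define y where "y = 5 - \<mu> * x + \<mu> * z"
      have "1 - \<mu> / 5 * x + \<mu> / 5 * z = 1/5 * y" "\<mu> * (z - x) = y - 5" by (simp_all add: y_def field_simps)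
      hence "g z * k z = (1/5)^5 * pos5 y * (std_normal_density x * exp (5 - y))"
        unfolding g_def k_def by (simp only: pos5_mult) (simp add: pos5_mult)
      also have "exp (5 - y) = exp 1 ^ 5 * exp (- y)"
        by (simp add: exp_diff exp_minus divide_inverse exp_of_nat_mult[symmetric])
      also have "pos5 y = y^5 * indicator {0..} y" by (simp add: pos5_def indicator_def max_def)
      finally show ?thesis unfolding y_def[symmetric] by (simp add: power_divide)
    qed
    moreover have "std_normal_density x * (exp 1 / 5)^5 * (fact 5 /\<^sub>R \<bar>\<mu>\<bar>) = fact 5 * (exp 1 / 5) ^ 5 * gauss_tail x"
      using mu by (simp add: phi)
    ultimately show ?thesis by (simp only:)
  qed
  have k1: "has_bochner_integral lborel (\<lambda>z. k z * indicator {x..} z) (gauss_tail x)"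
  proof -
    have "has_bochner_integral lborel
      (\<lambda>z. (- \<mu> * x + \<mu> * z) ^ 0 * exp (- (- \<mu> * x + \<mu> * z)) * indicator {0..} (- \<mu> * x + \<mu> * z)) (fact 0 /\<^sub>R \<bar>\<mu>\<bar>)"
      using has_bochner_integral_power_exp[of 0] mu by (subst (asm) lborel_has_bochner_integral_real_affine_iff[of \<mu> _ _ "- \<mu> * x"]) auto
    hence "has_bochner_integral lborel (\<lambda>z. std_normal_density x *
      ((- \<mu> * x + \<mu> * z) ^ 0 * exp (- (- \<mu> * x + \<mu> * z)) * indicator {0..} (- \<mu> * x + \<mu> * z)))
      (std_normal_density x * (fact 0 /\<^sub>R \<bar>\<mu>\<bar>))"
      by (rule has_bochner_integral_mult_right)
    moreover have "std_normal_density x *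
      ((- \<mu> * x + \<mu> * z) ^ 0 * exp (- (- \<mu> * x + \<mu> * z)) * indicator {0..} (- \<mu> * x + \<mu> * z))
      = k z * indicator {x..} z" for z
      using mu by (auto simp: k_def indicator_def algebra_simps)
    moreover have "std_normal_density x * (fact 0 /\<^sub>R \<bar>\<mu>\<bar>) = gauss_tail x"
      using mu by (simp add: phi)
    ultimately show ?thesis by (simp only:)
  qed
  have gphi: "has_bochner_integral lborel (\<lambda>z. g z * std_normal_density z) (gauss_pos5 (1 - \<mu> / 5 * x) (\<mu> / 5))"
    unfolding g_def gauss_pos5_def mult.commute[of "pos5 _"]
    by (rule has_bochner_integral_integrable[OF integrable_std_normal_pos5])
  have phi1: "has_bochner_integral lborel (\<lambda>z. std_normal_density z * indicator {x..} z) (gauss_tail x)"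
    using integrable_std_normal_indicator by (simp add: has_bochner_integral_iff gauss_tail_def)
  \<comment> \<open>The subtracted multiple of \<open>g z0\<close> integrates to zero, since both
    functions have the same mass on \<open>[x, \<infinity>)\<close>. It makes the integrand
    \<open>(g z - g z0) * (k z - std_normal_density z)\<close> there, a product of factors of equal
    sign.\<close>
  have D: "has_bochner_integral lborel (\<lambda>z. (g z * k z - g z * std_normal_density z)
      - g z0 * (k z * indicator {x..} z - std_normal_density z * indicator {x..} z))
    ((fact 5 * (exp 1 / 5) ^ 5 * gauss_tail x - gauss_pos5 (1 - \<mu> / 5 * x) (\<mu> / 5))
      - g z0 * (gauss_tail x - gauss_tail x))"
    by (intro has_bochner_integral_diff has_bochner_integral_mult_right gk k1 gphi phi1)
  have "0 \<le> (g z * k z - g z * std_normal_density z)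
      - g z0 * (k z * indicator {x..} z - std_normal_density z * indicator {x..} z)" for z
  proof (cases "z < x")
    case True
    hence "0 \<le> (z - x) * (z - z0)" using mux by (intro mult_nonpos_nonpos) (auto simp: z0_def)
    hence "std_normal_density z \<le> k z" by (simp add: sgn)
    hence "g z * std_normal_density z \<le> g z * k z" by (intro mult_left_mono) (auto simp: g_def)
    thus ?thesis using True by simp
  next
    case False
    have "0 \<le> (g z - g z0) * (k z - std_normal_density z)"
    proof (cases "z0 \<le> z")
      case True
      hence "std_normal_density z \<le> k z" using False by (simp add: sgn)
      thus ?thesis using gmono[OF True] by simp
    next
      case F: False
      hence "k z \<le> std_normal_density z"
      proof (cases "z = x")
        case True thus ?thesis by (simp add: k_def)
      next
        case N: False
        have "(z - x) * (z - z0) < 0" using F N False by (intro mult_pos_neg) auto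
        thus ?thesis using sgn[of z] by linarith
      qed
      thus ?thesis using gmono[of z z0] F by (intro mult_nonpos_nonpos) auto
    qed
    thus ?thesis using False by (simp add: algebra_simps)
  qed
  hence "0 \<le> (\<integral>z. (g z * k z - g z * std_normal_density z)
      - g z0 * (k z * indicator {x..} z - std_normal_density z * indicator {x..} z) \<partial>lborel)"
    by (intro Bochner_Integration.integral_nonneg)
  thus "gauss_pos5 (1 - \<mu> / 5 * x) (\<mu> / 5) \<le> fact 5 * (exp 1 / 5) ^ 5 * gauss_tail x"
    using has_bochner_integral_integral_eq[OF D] by simp
qed

subsection \<open>Stopping at the first crossing\<close>

text \<open>A real-valued stand-in for \<open>s_coeff\<close>, meaningful only where the conditional
  second moment is finite, as \<open>enn2real\<close> sends infinity to 0.\<close>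

definition s_real ::
  "'a measure \<Rightarrow> (nat \<Rightarrow> 'a measure) \<Rightarrow> (nat \<Rightarrow> 'a \<Rightarrow> real) \<Rightarrow> (nat \<Rightarrow> 'a \<Rightarrow> real)
     \<Rightarrow> nat \<Rightarrow> 'a \<Rightarrow> real" where
  "s_real M F X B i \<omega> = (B i \<omega> + enn2real (cond_square M F X i \<omega>) / B i \<omega>) / 2"

lemma s_coeff_finite:
  assumes "cond_square M F X i \<omega> < \<infinity>" "B i \<omega> \<noteq> 0"
  shows "s_coeff M F X B i \<omega> = ereal (s_real M F X B i \<omega>)"
proof -
  obtain c where c: "0 \<le> c" "cond_square M F X i \<omega> = ennreal c"
    using assms(1) by (cases "cond_square M F X i \<omega>") auto
  show ?thesis using assms(2) c by (simp add: s_coeff_def s_real_def)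
qed

lemma s_coeff_infinite:
  assumes "cond_square M F X i \<omega> = \<infinity>" "B i \<omega> \<noteq> 0"
  shows "(s_coeff M F X B i \<omega>)\<^sup>2 = \<infinity>"
proof (cases "0 < B i \<omega>")
  case True
  thus ?thesis using assms by (simp add: s_coeff_def power2_eq_square divide_ereal_def)
next
  case False
  thus ?thesis using assms by (simp add: s_coeff_def power2_eq_square divide_ereal_def)
qed

lemma ereal_power2_nonneg: "0 \<le> (a :: ereal)\<^sup>2"
  by (cases a) (auto simp: power2_eq_square)

text \<open>The summands are nonnegative, so a single infinite conditional second moment would make
  the whole sum infinite.\<close>

lemma V_square_le_real:
  assumes "V_square M F X B k \<omega> \<le> ereal c" "\<And>i. 1 \<le> i \<Longrightarrow> B i \<omega> \<noteq> 0"
  shows "\<forall>i\<in>{1..k}. cond_square M F X i \<omega> < \<infinity>"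
    and "V_square M F X B k \<omega> = ereal (\<Sum>i=1..k. (s_real M F X B i \<omega>)\<^sup>2)"
proof -
  have sq: "0 \<le> (s_coeff M F X B i \<omega>)\<^sup>2" for i by (simp add: ereal_power2_nonneg)
  show fin: "\<forall>i\<in>{1..k}. cond_square M F X i \<omega> < \<infinity>"
  proof (rule ccontr)
    assume "\<not> ?thesis"
    then obtain i where i: "i \<in> {1..k}" "cond_square M F X i \<omega> = \<infinity>"
      by (auto simp: less_top[symmetric])
    have "(s_coeff M F X B i \<omega>)\<^sup>2 \<le> V_square M F X B k \<omega>"
      unfolding V_square_def using i sq sum_mono2[of "{1..k}" "{i}" "\<lambda>i. (s_coeff M F X B i \<omega>)\<^sup>2"] by auto
    thus False using s_coeff_infinite[of M F X i \<omega> B] i assms by auto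
  qed
  have "(s_coeff M F X B i \<omega>)\<^sup>2 = ereal ((s_real M F X B i \<omega>)\<^sup>2)" if "i \<in> {1..k}" for i
    using that fin assms(2)[of i] s_coeff_finite[of M F X i \<omega> B] by (simp add: power2_eq_square)
  thus "V_square M F X B k \<omega> = ereal (\<Sum>i=1..k. (s_real M F X B i \<omega>)\<^sup>2)"
    unfolding V_square_def by simp
qed

lemma V_square_Suc_ge: "V_square M F X B k \<omega> \<le> V_square M F X B (Suc k) \<omega>"
proof -
  have "0 \<le> (s_coeff M F X B (Suc k) \<omega>)\<^sup>2" by (simp add: ereal_power2_nonneg)
  thus ?thesis unfolding V_square_def using add_left_mono by fastforce
qed

text \<open>The index runs up to \<open>Suc k\<close>: whether the variance bound still holds after
  the next step is decided at time \<open>k\<close>.\<close>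

lemma predictable_measurable:
  assumes "filtration (space M) F" "\<And>i. subalgebra M (F i)"
    and B: "\<And>i. 1 \<le> i \<Longrightarrow> B i \<in> borel_measurable (F (i - 1))"
  shows "1 \<le> i \<Longrightarrow> i \<le> Suc k \<Longrightarrow> B i \<in> borel_measurable (F k)"
    and "1 \<le> i \<Longrightarrow> i \<le> Suc k \<Longrightarrow> cond_square M F X i \<in> borel_measurable (F k)"
    and "i \<le> Suc k \<Longrightarrow> V_square M F X B i \<in> borel_measurable (F k)"
proof -
  have sub: "subalgebra (F k) (F j)" if "j \<le> k" for j
    using assms(1) that by (auto simp: subalgebra_def filtration_def)
  have Bi: "B i \<in> borel_measurable (F k)" if "1 \<le> i" "i \<le> Suc k" for i
    using measurable_from_subalg[OF sub B] that by auto
  have Ci: "cond_square M F X i \<in> borel_measurable (F k)" if "1 \<le> i" "i \<le> Suc k" for i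
    using measurable_from_subalg[OF sub borel_measurable_nn_cond_exp, of "i - 1"] that
    unfolding cond_square_def by auto
  show "1 \<le> i \<Longrightarrow> i \<le> Suc k \<Longrightarrow> B i \<in> borel_measurable (F k)" by (rule Bi)
  show "1 \<le> i \<Longrightarrow> i \<le> Suc k \<Longrightarrow> cond_square M F X i \<in> borel_measurable (F k)" by (rule Ci)
  have "(\<lambda>\<omega>. (s_coeff M F X B j \<omega>)\<^sup>2) \<in> borel_measurable (F k)" if "1 \<le> j" "j \<le> Suc k" for j
  proof -
    note [measurable] = Bi[OF that] Ci[OF that]
    show ?thesis unfolding s_coeff_def power2_eq_square by measurable
  qed
  thus "i \<le> Suc k \<Longrightarrow> V_square M F X B i \<in> borel_measurable (F k)"
    unfolding V_square_def by (intro borel_measurable_ereal_sum) auto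
qed

lemma tail_event_bound:
  fixes M :: "'a measure" and x v w :: real
  assumes M: "prob_space M"
    and sd: "supermartingale_difference M F X"
    and B: "\<And>i. 1 \<le> i \<Longrightarrow> B i \<in> borel_measurable (F (i - 1))"
    and B0: "\<And>i. 1 \<le> i \<Longrightarrow> AE \<omega> in M. B i \<omega> \<noteq> 0"
    and XB: "\<And>i. 1 \<le> i \<Longrightarrow> AE \<omega> in M. X i \<omega> \<le> B i \<omega>"
    and v: "0 < v"
  shows "ennreal (pos5 (x - w)) * emeasure M (\<Union>k\<in>{1..n}. tail_event M F X B x v k) \<le> ennreal (gauss_pos5 (- w) v)"
proof -
  interpret prob_space M by (rule M)
  have filt: "filtration (space M) F" and sub: "\<And>i. subalgebra M (F i)"
    and Xint: "\<And>i. integrable M (X i)" and XF: "\<And>i. X i \<in> borel_measurable (F i)"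
    and EX: "\<And>i. 1 \<le> i \<Longrightarrow> AE \<omega> in M. real_cond_exp M (F (i - 1)) (X i) \<omega> \<le> 0"
    using sd by (auto simp: supermartingale_difference_def)
  have spF: "space (F k) = space M" for k using filt by (simp add: filtration_def)
  have subF: "subalgebra (F k) (F j)" if "j \<le> k" for j k
    using filt that by (auto simp: subalgebra_def filtration_def)
  have FM: "A \<in> sets (F k) \<Longrightarrow> A \<in> sets M" for A k using sub[of k] by (auto simp: subalgebra_def)
  define S where "S k \<omega> = (\<Sum>i=1..k. X i \<omega>)" for k \<omega>
  define sr where "sr = s_real M F X B"
  define r where "r k \<omega> = v\<^sup>2 - (\<Sum>i=1..k. (sr i \<omega>)\<^sup>2)" for k \<omega>
  define A where "A k = {\<omega> \<in> space M. V_square M F X B k \<omega> \<le> ereal (v\<^sup>2)}" for k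
  define E where "E k = tail_event M F X B x v k" for k
  define H where "H k = (\<Union>j\<in>{1..k}. E j)" for k
  define Ug where "Ug k \<omega> = gauss_pos5 (S k \<omega> - w) (sqrt (r k \<omega>))" for k \<omega>
  have XFk: "X i \<in> borel_measurable (F k)" if "i \<le> k" for i k
    by (rule measurable_from_subalg[OF subF[OF that] XF])
  have SF: "S j \<in> borel_measurable (F k)" if "j \<le> k" for j k
    unfolding S_def using XFk that by (intro borel_measurable_sum) auto
  have srF: "sr i \<in> borel_measurable (F k)" if "1 \<le> i" "i \<le> Suc k" for i k
  proof -
    note [measurable] = predictable_measurable(1)[OF filt sub B that] predictable_measurable(2)[OF filt sub B that, where X=X]
    show ?thesis unfolding sr_def s_real_def[abs_def] by measurable
  qed
  have rF: "r j \<in> borel_measurable (F k)" if "j \<le> Suc k" for j k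
    unfolding r_def using srF that by (intro borel_measurable_diff borel_measurable_const borel_measurable_sum borel_measurable_power) auto
  have AF: "A j \<in> sets (F k)" if "j \<le> Suc k" for j k
  proof -
    note [measurable] = predictable_measurable(3)[OF filt sub B that, where X=X]
    have "{\<omega> \<in> space (F k). V_square M F X B j \<omega> \<le> ereal (v\<^sup>2)} \<in> sets (F k)" by measurable
    thus ?thesis by (simp add: A_def spF)
  qed
  have E_alt: "E k = {\<omega> \<in> space M. x \<le> S k \<omega>} \<inter> A k" for k
    by (auto simp: E_def tail_event_def A_def S_def)
  have EF: "E j \<in> sets (F k)" if "j \<le> k" for j k
  proof -
    note [measurable] = SF[OF that]
    have "{\<omega> \<in> space (F k). x \<le> S j \<omega>} \<in> sets (F k)" by measurable
    thus ?thesis unfolding E_alt using AF[of j k] that by (simp add: spF)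
  qed
  have HF: "H j \<in> sets (F k)" if "j \<le> k" for j k
    unfolding H_def using EF that by (intro sets.finite_UN) auto
  have Am: "A (Suc k) \<subseteq> A k" for k
    unfolding A_def by (auto intro: order_trans[OF V_square_Suc_ge])
  have AEB: "AE \<omega> in M. \<forall>i\<ge>1. B i \<omega> \<noteq> 0"
    using B0 by (auto simp: AE_all_countable intro: AE_impI)
  have AEA: "AE \<omega> in M. \<forall>k. \<omega> \<in> A k \<longrightarrow> 0 \<le> r k \<omega> \<and> (\<forall>i\<in>{1..k}. cond_square M F X i \<omega> < \<infinity> \<and> B i \<omega> \<noteq> 0)"
    using AEB
  proof eventually_elim
    case (elim \<omega>)
    show ?case
    proof (intro allI impI)
      fix k assume "\<omega> \<in> A k"
      hence V: "V_square M F X B k \<omega> \<le> ereal (v\<^sup>2)" by (simp add: A_def)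
      show "0 \<le> r k \<omega> \<and> (\<forall>i\<in>{1..k}. cond_square M F X i \<omega> < \<infinity> \<and> B i \<omega> \<noteq> 0)"
        using V_square_le_real[OF V] elim V by (auto simp: r_def sr_def)
    qed
  qed
  \<comment> \<open>Since \<open>r (Suc k)\<close> is \<open>F k\<close>-measurable, for fixed
    \<open>z\<close> the normal part of \<open>Ug (Suc k)\<close> is a shift to which the one-step
    bound applies. Averaging over \<open>z\<close> adds the variance of the step back to the budget,
    giving \<open>r k\<close>.\<close>
  have step: "(\<integral>\<^sup>+\<omega>\<in>Q. ennreal (Ug (Suc k) \<omega>) \<partial>M) \<le> (\<integral>\<^sup>+\<omega>\<in>Q. ennreal (Ug k \<omega>) \<partial>M)"
    if Q: "Q \<in> sets (F k)" "Q \<subseteq> A (Suc k)" for Q k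
  proof -
    interpret fs: finite_measure_subalgebra M "F k"
      by standard (rule sub)
    have QM [measurable]: "Q \<in> sets M" by (rule FM[OF Q(1)])
    have [measurable]: "S k \<in> borel_measurable (F k)" "r (Suc k) \<in> borel_measurable (F k)"
      "sr (Suc k) \<in> borel_measurable (F k)" by (auto intro: SF rF srF)
    have [measurable]: "S k \<in> borel_measurable M" "r (Suc k) \<in> borel_measurable M" "r k \<in> borel_measurable M"
      "sr (Suc k) \<in> borel_measurable M" "X (Suc k) \<in> borel_measurable M"
      using measurable_from_subalg[OF sub SF] measurable_from_subalg[OF sub rF, of _ k]
        measurable_from_subalg[OF sub srF, of _ k] measurable_from_subalg[OF sub XF] by auto
    have one: "(\<integral>\<^sup>+\<omega>\<in>Q. ennreal (pos5 ((S k \<omega> - w + sqrt (r (Suc k) \<omega>) * z) + X (Suc k) \<omega>)) \<partial>M)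
        \<le> (\<integral>\<^sup>+\<omega>\<in>Q. ennreal (gauss_pos5 (S k \<omega> - w + sqrt (r (Suc k) \<omega>) * z) (sr (Suc k) \<omega>)) \<partial>M)" for z
    proof -
      have C: "cond_square M F X (Suc k) = nn_cond_exp M (F k) (\<lambda>\<omega>. ennreal ((X (Suc k) \<omega>)\<^sup>2))"
        by (simp add: cond_square_def fun_eq_iff)
      show ?thesis unfolding sr_def s_real_def C
      proof (rule fs.pos5_one_step)
        show "AE \<omega> in M. real_cond_exp M (F k) (X (Suc k)) \<omega> \<le> 0" using EX[of "Suc k"] by simp
        show "B (Suc k) \<in> borel_measurable (F k)" using B[of "Suc k"] by simp
        show "AE \<omega> in M. \<omega> \<in> Q \<longrightarrow> nn_cond_exp M (F k) (\<lambda>\<omega>. ennreal ((X (Suc k) \<omega>)\<^sup>2)) \<omega> < \<infinity> \<and> B (Suc k) \<omega> \<noteq> 0"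
          using AEA by eventually_elim (use Q(2) in \<open>auto simp: C[symmetric]\<close>)
      qed (use Q(1) XB[of "Suc k"] Xint in auto)
    qed
    have "(\<integral>\<^sup>+\<omega>\<in>Q. ennreal (Ug (Suc k) \<omega>) \<partial>M)
      = (\<integral>\<^sup>+\<omega>. \<integral>\<^sup>+z. ennreal (std_normal_density z) *
          (ennreal (pos5 ((S k \<omega> - w + sqrt (r (Suc k) \<omega>) * z) + X (Suc k) \<omega>)) * indicator Q \<omega>) \<partial>lborel \<partial>M)"
    proof (rule nn_integral_cong)
      fix \<omega>
      have eq: "S (Suc k) \<omega> - w + s * z = (S k \<omega> - w + s * z) + X (Suc k) \<omega>" for s z
        by (simp add: S_def)
      show "ennreal (Ug (Suc k) \<omega>) * indicator Q \<omega> = (\<integral>\<^sup>+z. ennreal (std_normal_density z) *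
          (ennreal (pos5 ((S k \<omega> - w + sqrt (r (Suc k) \<omega>) * z) + X (Suc k) \<omega>)) * indicator Q \<omega>) \<partial>lborel)"
        unfolding Ug_def nn_integral_std_normal_pos5[symmetric] eq
        by (subst nn_integral_multc[symmetric]) (auto simp: mult_ac)
    qed
    also have "\<dots> = (\<integral>\<^sup>+z. \<integral>\<^sup>+\<omega>. ennreal (std_normal_density z) *
          (ennreal (pos5 ((S k \<omega> - w + sqrt (r (Suc k) \<omega>) * z) + X (Suc k) \<omega>)) * indicator Q \<omega>) \<partial>M \<partial>lborel)"
      by (rule pair_sigma_finite.Fubini'[OF pair_sigma_finite.intro[OF sigma_finite_lborel sigma_finite_measure_axioms]])
        measurable
    also have "\<dots> \<le> (\<integral>\<^sup>+z. \<integral>\<^sup>+\<omega>. ennreal (std_normal_density z) *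
          (ennreal (gauss_pos5 (S k \<omega> - w + sqrt (r (Suc k) \<omega>) * z) (sr (Suc k) \<omega>)) * indicator Q \<omega>) \<partial>M \<partial>lborel)"
    proof (rule nn_integral_mono)
      fix z
      show "(\<integral>\<^sup>+\<omega>. ennreal (std_normal_density z) *
          (ennreal (pos5 ((S k \<omega> - w + sqrt (r (Suc k) \<omega>) * z) + X (Suc k) \<omega>)) * indicator Q \<omega>) \<partial>M)
        \<le> (\<integral>\<^sup>+\<omega>. ennreal (std_normal_density z) *
          (ennreal (gauss_pos5 (S k \<omega> - w + sqrt (r (Suc k) \<omega>) * z) (sr (Suc k) \<omega>)) * indicator Q \<omega>) \<partial>M)"
        using one[of z] by (subst (1 2) nn_integral_cmult) (auto intro: mult_left_mono)
    qed
    also have "\<dots> = (\<integral>\<^sup>+\<omega>. \<integral>\<^sup>+z. ennreal (std_normal_density z) *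
          (ennreal (gauss_pos5 (S k \<omega> - w + sqrt (r (Suc k) \<omega>) * z) (sr (Suc k) \<omega>)) * indicator Q \<omega>) \<partial>lborel \<partial>M)"
      by (rule pair_sigma_finite.Fubini'[OF pair_sigma_finite.intro[OF sigma_finite_measure_axioms sigma_finite_lborel]])
        measurable
    also have "\<dots> = (\<integral>\<^sup>+\<omega>\<in>Q. ennreal (Ug k \<omega>) \<partial>M)"
    proof (rule nn_integral_cong_AE)
      show "AE \<omega> in M. (\<integral>\<^sup>+z. ennreal (std_normal_density z) *
          (ennreal (gauss_pos5 (S k \<omega> - w + sqrt (r (Suc k) \<omega>) * z) (sr (Suc k) \<omega>)) * indicator Q \<omega>) \<partial>lborel)
          = ennreal (Ug k \<omega>) * indicator Q \<omega>"
        using AEA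
      proof eventually_elim
        case (elim \<omega>)
        show ?case
        proof (cases "\<omega> \<in> Q")
          case True
          hence "0 \<le> r (Suc k) \<omega>" using elim Q(2) by auto
          moreover have "r k \<omega> = r (Suc k) \<omega> + (sr (Suc k) \<omega>)\<^sup>2" by (simp add: r_def)
          ultimately show ?thesis using True
            gauss_pos5_convolution[of "sqrt (r (Suc k) \<omega>)" "S k \<omega> - w" "sr (Suc k) \<omega>"]
            by (simp add: Ug_def)
        qed simp
      qed
    qed
    finally show ?thesis .
  qed
  have UgM: "Ug k \<in> borel_measurable M" for k
    using measurable_from_subalg[OF sub SF[OF order_refl], of k] measurable_from_subalg[OF sub rF[OF le_SucI[OF order_refl]], of k]
    unfolding Ug_def by (intro borel_measurable_gauss_pos5 borel_measurable_diff borel_measurable_const borel_measurable_sqrt) auto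
  \<comment> \<open>the mass already stopped, plus the potential of the paths that are still running, never increases\<close>
  have "ennreal (pos5 (x - w)) * emeasure M (H k) + (\<integral>\<^sup>+\<omega>\<in>A k - H k. ennreal (Ug k \<omega>) \<partial>M) \<le> ennreal (gauss_pos5 (- w) v)" for k
  proof (induction k)
    case 0
    have "(\<integral>\<^sup>+\<omega>\<in>A 0 - H 0. ennreal (Ug 0 \<omega>) \<partial>M) \<le> (\<integral>\<^sup>+\<omega>. ennreal (gauss_pos5 (- w) v) \<partial>M)"
      using v by (intro nn_integral_mono) (auto simp: Ug_def S_def r_def indicator_def)
    thus ?case by (simp add: H_def emeasure_space_1)
  next
    case (Suc k)
    \<comment> \<open>Running paths whose budget survives the next step; \<open>A (Suc k)\<close> is
      predictable, so \<open>Q\<close> lies in \<open>F k\<close>. The others are dropped, which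
      only lowers the nonnegative potential.\<close>
    define Q where "Q = A (Suc k) - H k"
    have QF: "Q \<in> sets (F k)" unfolding Q_def by (intro sets.Diff AF HF) auto
    have EM [measurable]: "E j \<in> sets M" "H j \<in> sets M" "A j \<in> sets M" for j
      using EF[of j j] HF[of j j] AF[of j j] FM by auto
    note [measurable] = UgM
    have HS: "H (Suc k) = H k \<union> (E (Suc k) - H k)" by (auto simp: H_def atLeastAtMostSuc_conv)
    have QS: "Q = (E (Suc k) - H k) \<union> (A (Suc k) - H (Suc k))"
      by (auto simp: Q_def HS E_alt)
    have "ennreal (pos5 (x - w)) * emeasure M (E (Suc k) - H k)
        = (\<integral>\<^sup>+\<omega>\<in>E (Suc k) - H k. ennreal (pos5 (x - w)) \<partial>M)"
      by (simp add: nn_integral_cmult_indicator)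
    also have "\<dots> \<le> (\<integral>\<^sup>+\<omega>\<in>E (Suc k) - H k. ennreal (Ug (Suc k) \<omega>) \<partial>M)"
    proof (intro nn_integral_mono)
      fix \<omega>
      have "pos5 (x - w) \<le> Ug (Suc k) \<omega>" if "\<omega> \<in> E (Suc k)"
        using that pos5_mono[of "x - w" "S (Suc k) \<omega> - w"] pos5_le_gauss[of "S (Suc k) \<omega> - w"]
        unfolding Ug_def by (auto simp: E_alt intro: order_trans)
      thus "ennreal (pos5 (x - w)) * indicator (E (Suc k) - H k) \<omega> \<le> ennreal (Ug (Suc k) \<omega>) * indicator (E (Suc k) - H k) \<omega>"
        by (auto simp: indicator_def intro: ennreal_leI)
    qed
    finally have hit: "ennreal (pos5 (x - w)) * emeasure M (E (Suc k) - H k)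
        + (\<integral>\<^sup>+\<omega>\<in>A (Suc k) - H (Suc k). ennreal (Ug (Suc k) \<omega>) \<partial>M)
        \<le> (\<integral>\<^sup>+\<omega>\<in>Q. ennreal (Ug (Suc k) \<omega>) \<partial>M)"
      unfolding QS by (subst nn_integral_disjoint_pair) (auto simp: HS intro: add_right_mono)
    also have "\<dots> \<le> (\<integral>\<^sup>+\<omega>\<in>Q. ennreal (Ug k \<omega>) \<partial>M)" by (rule step[OF QF]) (auto simp: Q_def)
    also have "\<dots> \<le> (\<integral>\<^sup>+\<omega>\<in>A k - H k. ennreal (Ug k \<omega>) \<partial>M)"
      using Am by (intro nn_set_integral_set_mono) (auto simp: Q_def)
    finally have "ennreal (pos5 (x - w)) * emeasure M (H k) + (ennreal (pos5 (x - w)) * emeasure M (E (Suc k) - H k)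
        + (\<integral>\<^sup>+\<omega>\<in>A (Suc k) - H (Suc k). ennreal (Ug (Suc k) \<omega>) \<partial>M)) \<le> ennreal (gauss_pos5 (- w) v)"
      using Suc.IH by (meson add_left_mono order_trans)
    moreover have "emeasure M (H (Suc k)) = emeasure M (H k) + emeasure M (E (Suc k) - H k)"
      unfolding HS by (rule plus_emeasure[symmetric]) auto
    ultimately show ?case by (simp add: distrib_left add.assoc)
  qed
  from this[of n] have "ennreal (pos5 (x - w)) * emeasure M (H n) \<le> ennreal (gauss_pos5 (- w) v)"
    by (rule order_trans[rotated]) simp
  thus ?thesis by (simp add: H_def E_def)
qed


lemma (in prob_space) AE_le_of_cond_prob_1:
  assumes "subalgebra M F" and [measurable]: "X \<in> borel_measurable M" "B \<in> borel_measurable M"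
    and 1: "AE \<omega> in M. real_cond_exp M F (indicator {\<omega> \<in> space M. X \<omega> \<le> B \<omega>}) \<omega> = 1"
  shows "AE \<omega> in M. X \<omega> \<le> (B \<omega> :: real)"
proof -
  interpret fs: finite_measure_subalgebra M F by standard (rule assms(1))
  have "integrable M (indicator {\<omega> \<in> space M. X \<omega> \<le> B \<omega>} :: 'a \<Rightarrow> real)"
    by (intro integrable_real_indicator) (auto simp: less_top[symmetric])
  hence "prob {\<omega> \<in> space M. X \<omega> \<le> B \<omega>} = (\<integral>\<omega>. real_cond_exp M F (indicator {\<omega> \<in> space M. X \<omega> \<le> B \<omega>}) \<omega> \<partial>M)"
    by (subst fs.real_cond_exp_int(2)) auto
  also have "\<dots> = (\<integral>\<omega>. 1 \<partial>M)" using 1 by (intro integral_cong_AE) auto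
  finally have "prob {\<omega> \<in> space M. X \<omega> \<le> B \<omega>} = 1" by (simp add: prob_space)
  thus ?thesis by (subst (asm) prob_Collect_eq_1) auto
qed

lemma normal_pos5_expectation:
  assumes "prob_space N" "distributed N lborel Z std_normal_density"
  shows "(\<integral>\<omega>. (max (1 + \<theta> / 5 * (v * Z \<omega> - x)) 0) ^ 5 \<partial>N) = gauss_pos5 (1 - \<theta> / 5 * x) (\<theta> / 5 * v)"
proof -
  interpret prob_space N by fact
  have "gauss_pos5 (1 - \<theta> / 5 * x) (\<theta> / 5 * v)
      = (\<integral>\<omega>. pos5 (1 - \<theta> / 5 * x + \<theta> / 5 * v * Z \<omega>) \<partial>N)"
    unfolding gauss_pos5_def by (rule distributed_integral[OF assms(2)]) auto
  also have "\<dots> = (\<integral>\<omega>. (max (1 + \<theta> / 5 * (v * Z \<omega> - x)) 0) ^ 5 \<partial>N)"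
    unfolding pos5_def by (simp add: algebra_simps diff_divide_distrib)
  finally show ?thesis ..
qed

lemma normal_tail:
  assumes "prob_space N" "distributed N lborel Z std_normal_density" "0 < v"
  shows "measure N {\<omega> \<in> space N. x \<le> v * Z \<omega>} = gauss_tail (x / v)"
proof -
  interpret prob_space N by fact
  have [measurable]: "Z \<in> borel_measurable N" using distributed_measurable[OF assms(2)] by simp
  have "gauss_tail (x / v) = (\<integral>\<omega>. indicator {x / v..} (Z \<omega>) \<partial>N)"
    unfolding gauss_tail_def by (rule distributed_integral[OF assms(2)]) auto
  also have "\<dots> = (\<integral>\<omega>. indicator {\<omega> \<in> space N. x \<le> v * Z \<omega>} \<omega> \<partial>N)"
    using assms(3) by (intro Bochner_Integration.integral_cong) (auto simp: indicator_def field_simps)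
  also have "\<dots> = measure N {\<omega> \<in> space N. x \<le> v * Z \<omega>}" by simp
  finally show ?thesis ..
qed

theorem theorem3p1:
  fixes M :: "'a measure" and F :: "nat \<Rightarrow> 'a measure"
    and X B :: "nat \<Rightarrow> 'a \<Rightarrow> real"
    and N :: "'b measure" and Z :: "'b \<Rightarrow> real"
    and n :: nat and x v :: real
  assumes "prob_space M"
    and "supermartingale_difference M F X"
    and "\<And>i. i \<ge> 1 \<Longrightarrow> B i \<in> borel_measurable (F (i - 1))"
    and "\<And>i. i \<ge> 1 \<Longrightarrow> AE \<omega> in M. B i \<omega> \<noteq> 0"
    and "\<And>i. i \<ge> 1 \<Longrightarrow>
           AE \<omega> in M. real_cond_exp M (F (i - 1))
             (indicator {\<omega> \<in> space M. X i \<omega> \<le> B i \<omega>}) \<omega> = 1"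
    and "prob_space N"
    and "distributed N lborel Z std_normal_density"
    and "n \<ge> 1" and "x \<ge> 0" and "v > 0"
  shows "measure M (\<Union>k\<in>{1..n}. tail_event M F X B x v k)
           \<le> (INF \<theta>\<in>{0..}. integral\<^sup>L N (\<lambda>\<omega>. (max (1 + \<theta> / 5 * (v * Z \<omega> - x)) 0) ^ 5))
       \<and> (INF \<theta>\<in>{0..}. integral\<^sup>L N (\<lambda>\<omega>. (max (1 + \<theta> / 5 * (v * Z \<omega> - x)) 0) ^ 5))
           \<le> fact 5 * (exp 1 / 5) ^ 5 * measure N {\<omega> \<in> space N. v * Z \<omega> \<ge> x}
       \<and> measure M {\<omega> \<in> space M. \<exists>m\<ge>1. (\<Sum>i=1..m. X i \<omega>) \<ge> x \<and>
             (\<Sum>i=1..m. (s_coeff M F X B i \<omega>)\<^sup>2) \<le> ereal (v\<^sup>2)}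
           \<le> (INF \<theta>\<in>{0..}. integral\<^sup>L N (\<lambda>\<omega>. (max (1 + \<theta> / 5 * (v * Z \<omega> - x)) 0) ^ 5))"
proof -
  interpret prob_space M by fact
  have filt: "filtration (space M) F" and sub: "\<And>i. subalgebra M (F i)"
    and XM [measurable]: "\<And>i. X i \<in> borel_measurable M"
    using assms(2) by (auto simp: supermartingale_difference_def)
  have VM [measurable]: "V_square M F X B k \<in> borel_measurable M" for k
    using measurable_from_subalg[OF sub predictable_measurable(3)[OF filt sub assms(3), of k k X]] by simp
  have EM [measurable]: "tail_event M F X B x v k \<in> sets M" for k
    unfolding tail_event_def by measurable
  have XB: "AE \<omega> in M. X i \<omega> \<le> B i \<omega>" if "1 \<le> i" for i
    using measurable_from_subalg[OF sub assms(3)[OF that]]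
    by (intro AE_le_of_cond_prob_1[OF sub _ _ assms(5)[OF that]]) auto
  define I where "I = (INF \<theta>\<in>{0..}. integral\<^sup>L N (\<lambda>\<omega>. (max (1 + \<theta> / 5 * (v * Z \<omega> - x)) 0) ^ 5))"
  have I: "I = (INF \<theta>\<in>{0..}. gauss_pos5 (1 - \<theta> / 5 * x) (\<theta> / 5 * v))"
    unfolding I_def normal_pos5_expectation[OF assms(6,7)] ..
  \<comment> \<open>\<open>n\<close> is universally quantified here, because the infinite-horizon
    bound lets it tend to infinity.\<close>
  have finite: "prob (\<Union>k\<in>{1..n}. tail_event M F X B x v k) \<le> I" for n
    unfolding I
  proof (rule cINF_greatest)
    fix \<theta> :: real assume "\<theta> \<in> {0..}"
    hence \<theta>: "0 \<le> \<theta>" by simp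
    let ?H = "\<Union>k\<in>{1..n}. tail_event M F X B x v k"
    show "prob ?H \<le> gauss_pos5 (1 - \<theta> / 5 * x) (\<theta> / 5 * v)"
    proof (cases "\<theta> = 0")
      case True
      have "gauss_pos5 1 0 = 1" by (simp add: gauss_pos5_def pos5_def)
      thus ?thesis using True by simp
    next
      case False
      define w where "w = x - 5 / \<theta>"
      have "ennreal (pos5 (x - w) * prob ?H) \<le> ennreal (gauss_pos5 (- w) v)"
        using tail_event_bound[OF assms(1-4) XB assms(10), of x w n]
        by (simp add: emeasure_eq_measure ennreal_mult)
      hence "pos5 (x - w) * prob ?H \<le> gauss_pos5 (- w) v"
        by (simp add: ennreal_le_iff)
      \<comment> \<open>Since \<open>x - w = 5 / \<theta>\<close>, this factor normalises
        \<open>pos5 (x - w)\<close> to 1.\<close>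
      hence "(\<theta> / 5) ^ 5 * (pos5 (x - w) * prob ?H) \<le> (\<theta> / 5) ^ 5 * gauss_pos5 (- w) v"
        using \<theta> by (intro mult_left_mono) auto
      also have "(\<theta> / 5) ^ 5 * gauss_pos5 (- w) v = gauss_pos5 (1 - \<theta> / 5 * x) (\<theta> / 5 * v)"
      proof -
        have "\<theta> / 5 * - w = 1 - \<theta> / 5 * x" using False by (simp add: w_def field_simps)
        thus ?thesis using gauss_pos5_scale[of "\<theta> / 5" "- w" v] \<theta> by simp
      qed
      also have "(\<theta> / 5) ^ 5 * (pos5 (x - w) * prob ?H) = prob ?H"
        using \<theta> False by (simp add: w_def pos5_def power_divide)
      finally show ?thesis .
    qed
  qed simp
  have "I \<le> fact 5 * (exp 1 / 5) ^ 5 * gauss_tail (x / v)"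
  proof -
    obtain \<mu> where \<mu>: "0 < \<mu>"
      "gauss_pos5 (1 - \<mu> / 5 * (x / v)) (\<mu> / 5) \<le> fact 5 * (exp 1 / 5) ^ 5 * gauss_tail (x / v)"
      using gauss_pos5_le_tail[of "x / v"] assms(9,10) by auto
    \<comment> \<open>The rate found for the standard normal level \<open>x / v\<close> is divided
      by \<open>v\<close> to undo the scaling.\<close>
    have "I \<le> gauss_pos5 (1 - (\<mu> / v) / 5 * x) ((\<mu> / v) / 5 * v)"
      unfolding I using \<mu>(1) assms(10)
      by (intro cINF_lower bdd_belowI2[of _ 0]) auto
    also have "\<dots> = gauss_pos5 (1 - \<mu> / 5 * (x / v)) (\<mu> / 5)" using assms(10) by (simp add: mult.commute)
    finally show ?thesis using \<mu>(2) by linarith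
  qed
  moreover have "prob {\<omega> \<in> space M. \<exists>m\<ge>1. (\<Sum>i=1..m. X i \<omega>) \<ge> x \<and>
             (\<Sum>i=1..m. (s_coeff M F X B i \<omega>)\<^sup>2) \<le> ereal (v\<^sup>2)} \<le> I"
  proof -
    have "{\<omega> \<in> space M. \<exists>m\<ge>1. (\<Sum>i=1..m. X i \<omega>) \<ge> x \<and>
             (\<Sum>i=1..m. (s_coeff M F X B i \<omega>)\<^sup>2) \<le> ereal (v\<^sup>2)}
        = (\<Union>n. \<Union>k\<in>{1..n}. tail_event M F X B x v k)"
      by (fastforce simp: tail_event_def V_square_def)
    moreover have "(\<lambda>n. prob (\<Union>k\<in>{1..n}. tail_event M F X B x v k))
        \<longlonglongrightarrow> prob (\<Union>n. \<Union>k\<in>{1..n}. tail_event M F X B x v k)"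
      by (intro finite_Lim_measure_incseq monoI UN_mono) auto
    ultimately show ?thesis using LIMSEQ_le_const2[of _ _ I] finite by auto
  qed
  ultimately show ?thesis
    using finite[of n] unfolding normal_tail[OF assms(6,7,10)] I_def by simp
qed

end
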